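(* Let $T_0>0$, $\Theta\subseteq\mathbb{R}^K$ open, and $\theta\mapsto h_\theta$ a mapping from $\Theta$ into the real functions in $L_2[0,T_0]$ satisfying (P6) Fréchet differentiability with derivative $D_\theta=\frac{\partial h_\theta}{\partial\theta}:\mathbb{R}^K\to L_2[0,T_0]$ continuous linear, and (P7) $\mathcal{N}(D_\theta)=\{0\}$. Let $x=h_\theta$ with $\theta\in\Theta$ unknown deterministic, let $y=x+w$ with $w$ continuous-time white Gaussian noise of level $\sigma_c^2$, and let real sampling kernels $s_1,\dots,s_N\in L_2[0,T_0]$ produce measurements $c_n=\langle y,s_n\rangle+v_n$, $n=1,\dots,N$, where $v_1,\dots,v_N$ are i.i.d. $N(0,\sigma_d^2)$ independent of $w$; assume $\sigma_c^2S^*S+\sigma_d^2 I_N$ is invertible. Then the Fisher information matrix for estimating $\theta$ from $c=(c_1,\dots,c_N)^T$ is $$J^{\mathrm{samp}}_\theta=D_\theta^*\,S\,(\sigma_c^2S^*S+\sigma_d^2I_N)^{-1}S^*\,D_\theta,$$ where $S$ is the set transformation of $\{s_n\}$. If moreover $\mathcal{R}(D_\theta)\cap\mathcal{S}^\perp=\{0\}$, where $\mathcal{S}=\operatorname{span}\{s_1,\dots,s_N\}$, then $J^{\mathrm{samp}}_\theta$ is invertible and every unbiased estimator $\hat x$ of $x$ from $c$ with finite second moment satisfies $$\mathbb{E}_\theta\|\hat x-x\|_{L_2}^2\ge\operatorname{Tr}\big[D_\theta^*D_\theta\,(J^{\mathrm{samp}}_\theta)^{-1}\big].$$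
   Context: $\langle f,g\rangle=\int_0^{T_0}f(t)g^*(t)dt$. White noise $w$: for $f,g\in L_2$, $\langle f,w\rangle,\langle g,w\rangle$ are zero-mean jointly Gaussian with $\mathbb{E}[\langle f,w\rangle\langle g,w\rangle^*]=\sigma_c^2\langle f,g\rangle$. The set transformation $S:\mathbb{C}^N\to L_2$ of functions $s_1,\dots,s_N$ is $S v=\sum_n v_n s_n$, so $S^*f=(\langle f,s_1\rangle,\dots,\langle f,s_N\rangle)^T$. $\mathcal{R}$, $\mathcal{N}$ denote range and null space; unbiased means $\mathbb{E}_\theta[\hat x]=h_\theta$ for all $\theta$ (weak expectation). *)

theory Defs
  imports "HOL-Probability.Probability"
begin

text \<open>Real square-integrable functions on [0,T0]; elements are represented by
  functions real => real (values outside [0,T0] are irrelevant).\<close>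
definition L2 :: "real \<Rightarrow> (real \<Rightarrow> real) set" where
  "L2 T0 = {f. set_borel_measurable lborel {0..T0} f \<and>
                set_integrable lborel {0..T0} (\<lambda>t. (f t)\<^sup>2)}"

definition inner_L2 :: "real \<Rightarrow> (real \<Rightarrow> real) \<Rightarrow> (real \<Rightarrow> real) \<Rightarrow> real" where
  "inner_L2 T0 f g = (LINT t:{0..T0}|lborel. f t * g t)"

definition norm_L2 :: "real \<Rightarrow> (real \<Rightarrow> real) \<Rightarrow> real" where
  "norm_L2 T0 f = sqrt (LINT t:{0..T0}|lborel. (f t)\<^sup>2)"

text \<open>Squared L2 norm as an extended nonnegative real (total; infinite if f is not
  square integrable).\<close>
definition sqnorm_L2 :: "real \<Rightarrow> (real \<Rightarrow> real) \<Rightarrow> ennreal" where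
  "sqnorm_L2 T0 f = (\<integral>\<^sup>+ t. indicator {0..T0} t * ennreal ((f t)\<^sup>2) \<partial>lborel)"

definition Dop :: "('k::finite \<Rightarrow> real \<Rightarrow> real) \<Rightarrow> real^'k \<Rightarrow> real \<Rightarrow> real" where
  "Dop d \<delta> = (\<lambda>t. \<Sum>k\<in>UNIV. \<delta>$k * d k t)"

definition gram_SS :: "real \<Rightarrow> ('n::finite \<Rightarrow> real \<Rightarrow> real) \<Rightarrow> real^'n^'n" where
  "gram_SS T0 s = (\<chi> n m. inner_L2 T0 (s m) (s n))"

definition mat_SD :: "real \<Rightarrow> ('n::finite \<Rightarrow> real \<Rightarrow> real) \<Rightarrow> ('k::finite \<Rightarrow> real \<Rightarrow> real) \<Rightarrow> real^'k^'n" where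
  "mat_SD T0 s d = (\<chi> n k. inner_L2 T0 (d k) (s n))"

definition mat_DD :: "real \<Rightarrow> ('k::finite \<Rightarrow> real \<Rightarrow> real) \<Rightarrow> real^'k^'k" where
  "mat_DD T0 d = (\<chi> i j. inner_L2 T0 (d j) (d i))"

definition J_samp :: "real \<Rightarrow> real \<Rightarrow> real \<Rightarrow> ('n::finite \<Rightarrow> real \<Rightarrow> real) \<Rightarrow> ('k::finite \<Rightarrow> real \<Rightarrow> real) \<Rightarrow> real^'k^'k" where
  "J_samp T0 sc2 sd2 s d =
     transpose (mat_SD T0 s d) ** matrix_inv (sc2 *\<^sub>R gram_SS T0 s + sd2 *\<^sub>R mat 1) ** mat_SD T0 s d"

definition gaussian_rv :: "'a measure \<Rightarrow> ('a \<Rightarrow> real) \<Rightarrow> real \<Rightarrow> real \<Rightarrow> bool" where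
  "gaussian_rv M X m s2 \<longleftrightarrow> X \<in> borel_measurable M \<and> s2 \<ge> 0 \<and>
     (if s2 = 0 then distr M borel X = return borel m
      else distributed M lborel X (normal_density m (sqrt s2)))"

text \<open>W f plays the role of <f,w>. White noise of level sc2 on L2[0,T0]: for every finite
  family of L2 functions the variables W f are jointly Gaussian, zero mean, with
  E[W f W g] = sc2 <f,g>; equivalently every finite linear combination is Gaussian with mean 0
  and variance sc2 * ||sum a_f f||^2.\<close>
definition white_noise :: "'a measure \<Rightarrow> real \<Rightarrow> real \<Rightarrow> ((real \<Rightarrow> real) \<Rightarrow> 'a \<Rightarrow> real) \<Rightarrow> bool" where
  "white_noise M T0 sc2 W \<longleftrightarrow>
     (\<forall>F a. finite F \<and> F \<subseteq> L2 T0 \<longrightarrow>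
        gaussian_rv M (\<lambda>\<omega>. \<Sum>f\<in>F. a f * W f \<omega>) 0
          (sc2 * (norm_L2 T0 (\<lambda>t. \<Sum>f\<in>F. a f * f t))\<^sup>2))"

definition is_fisher_information ::
  "(real^'k::finite \<Rightarrow> (real^'n::finite) measure) \<Rightarrow> (real^'k) set \<Rightarrow> real^'k \<Rightarrow> real^'k^'k \<Rightarrow> bool" where
  "is_fisher_information P \<Theta> \<theta> J \<longleftrightarrow>
     (\<exists>p :: real^'k \<Rightarrow> real^'n \<Rightarrow> real.
        (\<lambda>(\<theta>', z). p \<theta>' z) \<in> borel_measurable borel \<and>
        (\<forall>\<theta>'\<in>\<Theta>. (\<forall>z. p \<theta>' z \<ge> 0) \<and> P \<theta>' = density lborel (\<lambda>z. ennreal (p \<theta>' z))) \<and>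
        (AE z in P \<theta>. p \<theta> z > 0 \<and> (\<lambda>\<theta>'. ln (p \<theta>' z)) differentiable (at \<theta>)) \<and>
        (\<forall>i j. integrable (P \<theta>) (\<lambda>z. frechet_derivative (\<lambda>\<theta>'. ln (p \<theta>' z)) (at \<theta>) (axis i 1) *
                                      frechet_derivative (\<lambda>\<theta>'. ln (p \<theta>' z)) (at \<theta>) (axis j 1))) \<and>
        J = (\<chi> i j. \<integral>z. frechet_derivative (\<lambda>\<theta>'. ln (p \<theta>' z)) (at \<theta>) (axis i 1) *
                          frechet_derivative (\<lambda>\<theta>'. ln (p \<theta>' z)) (at \<theta>) (axis j 1) \<partial>P \<theta>))"

definition fisher_information ::
  "(real^'k::finite \<Rightarrow> (real^'n::finite) measure) \<Rightarrow> (real^'k) set \<Rightarrow> real^'k \<Rightarrow> real^'k^'k" where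
  "fisher_information P \<Theta> \<theta> = (THE J. is_fisher_information P \<Theta> \<theta> J)"

end

theory Submission
  imports Defs
begin

text \<open>
  Every linear combination of the noise vector is a centred Gaussian, so by uniqueness of
  multivariate characteristic functions the samples \<open>c\<close> have a Gaussian law with mean
  \<open>S\<^sup>* h\<^sub>\<theta>\<close> and positive definite covariance \<open>V = \<sigma>\<^sub>c\<^sup>2 S\<^sup>* S + \<sigma>\<^sub>d\<^sup>2 I\<close>; with
  \<open>K = V\<^sup>-\<^sup>1\<close> and \<open>A = S\<^sup>* D\<^sub>\<theta>\<close>, the score in direction \<open>\<delta>\<close> is
  \<open>(c - S\<^sup>* h\<^sub>\<theta>) \<bullet> K A \<delta>\<close> and has covariance \<open>A\<^sup>T K A\<close>.

  For the bound, write \<open>L\<^sub>m\<close> for the likelihood ratio of a shift of the mean by \<open>m\<close>, and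
  \<open>q = m \<bullet> K m\<close>. Translation invariance of Lebesgue measure gives
  \<open>E (L\<^sub>m - 1 - z \<bullet> K m)\<^sup>2 = exp q - 1 - q\<close>, so difference quotients of \<open>L\<^sub>m\<close> converge to the
  score in mean square. Unbiasedness can therefore be differentiated: the covariance of the
  score in direction \<open>j\<close> with \<open>\<langle>xh, d k\<rangle>\<close> is \<open>\<langle>d j, d k\<rangle>\<close>. Comparing the error with its
  regression on the score yields the trace bound.
\<close>

section \<open>Square-integrable functions\<close>

text \<open>The estimator is only known to be jointly measurable with finite second moments, so
  nothing dominates the integrand when unbiasedness is differentiated under the integral. This is
  why the likelihood ratio is expanded in mean square: Cauchy-Schwarz against the second moment at
  \<open>\<theta>\<close> then controls the remainder. Unbiasedness holds only weakly, which is
  enough, since the scalar statistics to be differentiated are the inner products with the functions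
  \<open>d \<theta> k\<close>. Either noise level may be zero. One-dimensional laws may therefore be
  point masses, and definiteness of the covariance has to come from its invertibility. The
  normalising constant of the density is never evaluated, because it drops out of the score and of
  every likelihood ratio. Finally, \<open>fisher_information\<close> is a definite description over
  all versions of the densities, so its value requires uniqueness across versions besides one
  explicit family.\<close>

lemma L2_iff:
  "f \<in> L2 T \<longleftrightarrow> (\<lambda>t. indicator {0..T} t * f t) \<in> borel_measurable borel \<and>
     integrable lborel (\<lambda>t. (indicator {0..T} t * f t)\<^sup>2)"
proof -
  have "(indicator {0..T} t * f t)\<^sup>2 = indicator {0..T} t * (f t)\<^sup>2" for t
    by (simp add: indicator_def)
  then show ?thesis
    by (simp add: L2_def set_borel_measurable_def set_integrable_def)
qed

text \<open>Truncating both factors gives integrals over the whole line, so general facts on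
  square-integrable functions apply although elements of \<open>L2\<close> are unrestricted off the
  interval.\<close>

lemma inner_L2_eq: "inner_L2 T f g = (\<integral>t. (indicator {0..T} t * f t) * (indicator {0..T} t * g t) \<partial>lborel)"
  unfolding inner_L2_def set_lebesgue_integral_def
  by (intro Bochner_Integration.integral_cong refl) (simp add: indicator_def)

lemma integrable_mult_of_square:
  fixes f g :: "'a \<Rightarrow> real"
  assumes [measurable]: "f \<in> borel_measurable M" "g \<in> borel_measurable M"
    and "integrable M (\<lambda>x. (f x)\<^sup>2)" "integrable M (\<lambda>x. (g x)\<^sup>2)"
  shows "integrable M (\<lambda>x. f x * g x)"
proof (rule Bochner_Integration.integrable_bound)
  show "integrable M (\<lambda>x. (f x)\<^sup>2 + (g x)\<^sup>2)" using assms by simp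
  show "AE x in M. norm (f x * g x) \<le> norm ((f x)\<^sup>2 + (g x)\<^sup>2)"
  proof (rule AE_I2)
    fix x
    have "2 * (\<bar>f x\<bar> * \<bar>g x\<bar>) \<le> (f x)\<^sup>2 + (g x)\<^sup>2"
      using sum_squares_bound[of "\<bar>f x\<bar>" "\<bar>g x\<bar>"] by simp
    moreover have "0 \<le> \<bar>f x\<bar> * \<bar>g x\<bar>" by simp
    ultimately show "norm (f x * g x) \<le> norm ((f x)\<^sup>2 + (g x)\<^sup>2)"
      unfolding real_norm_def abs_mult by linarith
  qed
qed simp

lemma quadratic_nonneg_imp_discriminant:
  fixes a b c :: real
  assumes "\<And>t. 0 \<le> a - 2 * t * b + t\<^sup>2 * c" and "0 \<le> c"
  shows "b\<^sup>2 \<le> a * c"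
proof (cases "c = 0")
  case True
  have "b = 0"
  proof (rule ccontr)
    assume "b \<noteq> 0"
    \<comment> \<open>At this \<open>t\<close> the linear function \<open>a - 2 * t * b\<close>
      equals -1.\<close>
    then show False using assms(1)[of "(a + 1) / (2 * b)"] True by (simp add: field_simps)
  qed
  then show ?thesis using True by simp
next
  case False
  with assms have "c > 0" by simp
  \<comment> \<open>The point \<open>b / c\<close> minimises the quadratic.\<close>
  then show ?thesis
    using assms(1)[of "b / c"] by (simp add: field_simps power2_eq_square)
qed

lemma integral_Cauchy_Schwarz:
  fixes f g :: "'a \<Rightarrow> real"
  assumes [measurable]: "f \<in> borel_measurable M" "g \<in> borel_measurable M"
    and f: "integrable M (\<lambda>x. (f x)\<^sup>2)" and g: "integrable M (\<lambda>x. (g x)\<^sup>2)"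
  shows "(\<integral>x. f x * g x \<partial>M)\<^sup>2 \<le> (\<integral>x. (f x)\<^sup>2 \<partial>M) * (\<integral>x. (g x)\<^sup>2 \<partial>M)"
proof (rule quadratic_nonneg_imp_discriminant)
  have fg: "integrable M (\<lambda>x. f x * g x)" using assms by (rule integrable_mult_of_square)
  fix t
  have "0 \<le> (\<integral>x. (f x - t * g x)\<^sup>2 \<partial>M)" by (intro Bochner_Integration.integral_nonneg) simp
  also have "\<dots> = (\<integral>x. (f x)\<^sup>2 - 2 * t * (f x * g x) + t\<^sup>2 * (g x)\<^sup>2 \<partial>M)"
    by (intro Bochner_Integration.integral_cong refl) (simp add: power2_eq_square algebra_simps)
  also have "\<dots> = (\<integral>x. (f x)\<^sup>2 \<partial>M) - 2 * t * (\<integral>x. f x * g x \<partial>M) + t\<^sup>2 * (\<integral>x. (g x)\<^sup>2 \<partial>M)"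
    using f g fg by simp
  finally show "0 \<le> \<dots>" .
qed (intro Bochner_Integration.integral_nonneg, simp)

lemma L2_integrable_mult:
  assumes "f \<in> L2 T" "g \<in> L2 T"
  shows "integrable lborel (\<lambda>t. (indicator {0..T} t * f t) * (indicator {0..T} t * g t))"
  using assms unfolding L2_iff by (intro integrable_mult_of_square) auto

lemma L2_zero: "(\<lambda>t. 0) \<in> L2 T"
  by (simp add: L2_iff)

lemma L2_cmult: "f \<in> L2 T \<Longrightarrow> (\<lambda>t. a * f t) \<in> L2 T"
  unfolding L2_iff by (auto simp: mult.left_commute[of _ a] power_mult_distrib[of a])

lemma L2_add:
  assumes "f \<in> L2 T" "g \<in> L2 T"
  shows "(\<lambda>t. f t + g t) \<in> L2 T"
proof -
  have "(indicator {0..T} t * (f t + g t))\<^sup>2 = (indicator {0..T} t * f t)\<^sup>2 + (indicator {0..T} t * g t)\<^sup>2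
      + 2 * ((indicator {0..T} t * f t) * (indicator {0..T} t * g t))" for t
    by (simp add: power2_eq_square algebra_simps)
  then show ?thesis
    using assms L2_integrable_mult[OF assms] unfolding L2_iff by (auto simp: distrib_left)
qed

lemma L2_diff: "f \<in> L2 T \<Longrightarrow> g \<in> L2 T \<Longrightarrow> (\<lambda>t. f t - g t) \<in> L2 T"
  using L2_add[of f T "\<lambda>t. -1 * g t"] L2_cmult[of g T "-1"] by simp

lemma L2_sum: "(\<And>i. i \<in> I \<Longrightarrow> f i \<in> L2 T) \<Longrightarrow> (\<lambda>t. \<Sum>i\<in>I. f i t) \<in> L2 T"
  by (induction I rule: infinite_finite_induct) (auto intro: L2_zero L2_add)

lemma inner_L2_commute: "inner_L2 T f g = inner_L2 T g f"
  by (simp add: inner_L2_def mult.commute)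

lemma inner_L2_cmult_left: "inner_L2 T (\<lambda>t. a * f t) g = a * inner_L2 T f g"
  by (simp add: inner_L2_def mult.assoc)

lemma inner_L2_add_left:
  assumes "f \<in> L2 T" "g \<in> L2 T" "k \<in> L2 T"
  shows "inner_L2 T (\<lambda>t. f t + g t) k = inner_L2 T f k + inner_L2 T g k"
  using L2_integrable_mult[OF assms(1,3)] L2_integrable_mult[OF assms(2,3)]
  by (simp add: inner_L2_eq distrib_left distrib_right)

lemma inner_L2_diff_left:
  assumes "f \<in> L2 T" "g \<in> L2 T" "k \<in> L2 T"
  shows "inner_L2 T (\<lambda>t. f t - g t) k = inner_L2 T f k - inner_L2 T g k"
  using L2_integrable_mult[OF assms(1,3)] L2_integrable_mult[OF assms(2,3)]
  by (simp add: inner_L2_eq right_diff_distrib left_diff_distrib)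

lemma inner_L2_sum_left:
  assumes "\<And>i. i \<in> I \<Longrightarrow> f i \<in> L2 T" "k \<in> L2 T"
  shows "inner_L2 T (\<lambda>t. \<Sum>i\<in>I. f i t) k = (\<Sum>i\<in>I. inner_L2 T (f i) k)"
  using assms(1)
proof (induction I rule: infinite_finite_induct)
  case (insert i I)
  then show ?case
    using inner_L2_add_left[of "f i" T "\<lambda>t. \<Sum>i\<in>I. f i t" k] assms(2) by (simp add: L2_sum)
qed (simp_all add: inner_L2_def)

lemma norm_L2_power2: "(norm_L2 T f)\<^sup>2 = inner_L2 T f f"
proof -
  have "0 \<le> (LINT t:{0..T}|lborel. (f t)\<^sup>2)"
    unfolding set_lebesgue_integral_def by (intro Bochner_Integration.integral_nonneg) simp
  then show ?thesis by (simp add: norm_L2_def inner_L2_def power2_eq_square)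
qed

lemma norm_L2_nonneg: "0 \<le> norm_L2 T f"
  unfolding norm_L2_def set_lebesgue_integral_def
  by (intro real_sqrt_ge_zero Bochner_Integration.integral_nonneg) simp

lemma inner_L2_Cauchy_Schwarz:
  assumes "f \<in> L2 T" "g \<in> L2 T"
  shows "\<bar>inner_L2 T f g\<bar> \<le> norm_L2 T f * norm_L2 T g"
proof (rule power2_le_imp_le)
  have "(inner_L2 T f g)\<^sup>2 \<le> inner_L2 T f f * inner_L2 T g g"
    unfolding inner_L2_eq using assms unfolding L2_iff
    by (intro order_trans[OF integral_Cauchy_Schwarz]) (auto simp: power2_eq_square)
  then show "\<bar>inner_L2 T f g\<bar>\<^sup>2 \<le> (norm_L2 T f * norm_L2 T g)\<^sup>2"
    by (simp add: power_mult_distrib norm_L2_power2)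
qed (simp add: norm_L2_nonneg)

lemma sqnorm_L2_eq: "sqnorm_L2 T f = (\<integral>\<^sup>+t. ennreal ((indicator {0..T} t * f t)\<^sup>2) \<partial>lborel)"
  unfolding sqnorm_L2_def by (intro nn_integral_cong) (simp add: indicator_def)

lemma sqnorm_L2_of_L2:
  assumes "f \<in> L2 T"
  shows "sqnorm_L2 T f = ennreal (inner_L2 T f f)"
  using assms unfolding sqnorm_L2_eq inner_L2_eq L2_iff
  by (subst nn_integral_eq_integral) (auto simp: power2_eq_square)

lemma L2_of_sqnorm_L2:
  assumes "(\<lambda>t. indicator {0..T} t * f t) \<in> borel_measurable borel" "sqnorm_L2 T f < \<infinity>"
  shows "f \<in> L2 T"
  using assms unfolding L2_iff sqnorm_L2_eq
  by (auto intro!: integrableI_nonneg)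

section \<open>Uniqueness of multivariate characteristic functions\<close>

text \<open>Divided by its total mass, \<open>f\<close> is a probability density, and the hypothesis
  says that \<open>X\<close> has the same characteristic function under both weighted measures, so
  Levy uniqueness on the line applies. In the induction below the weight carries the remaining
  coordinates.\<close>

lemma integral_indicator_eqI_char:
  fixes M N :: "'a measure" and X f :: "'a \<Rightarrow> real"
  assumes "finite_measure M" "finite_measure N"
    and fM: "f \<in> borel_measurable M" "X \<in> borel_measurable M"
    and fN: "f \<in> borel_measurable N" "X \<in> borel_measurable N"
    and f: "\<And>x. 0 \<le> f x" "\<And>x. f x \<le> C"
    and eq: "\<And>t. (CLINT x|M. f x * iexp (t * X x)) = (CLINT x|N. f x * iexp (t * X x))"
    and B: "B \<in> sets borel"
  shows "(\<integral>x. f x * indicator B (X x) \<partial>M) = (\<integral>x. f x * indicator B (X x) \<partial>N)"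
proof -
  define c where "c = (\<integral>x. f x \<partial>M)"
  have intf: "integrable K f" if "finite_measure K" "f \<in> borel_measurable K" for K
    using that f by (intro finite_measure.integrable_const_bound[where B=C]) auto
  have iM: "integrable M f" and iN: "integrable N f" using intf[OF assms(1) fM(1)] intf[OF assms(2) fN(1)] by blast+
  \<comment> \<open>Frequency 0 shows that the total masses agree.\<close>
  have cN: "c = (\<integral>x. f x \<partial>N)"
  proof -
    have "complex_of_real c = of_real (\<integral>x. f x \<partial>N)"
      unfolding c_def using eq[of 0] by (simp flip: integral_complex_of_real)
    then show ?thesis by simp
  qed
  show ?thesis
  proof (cases "c = 0")
    case True
    have "(\<integral>x. f x * indicator B (X x) \<partial>K) = 0" if "integrable K f" "(\<integral>x. f x \<partial>K) = 0" for K
    proof -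
      have "AE x in K. f x = 0"
        using that f by (subst (asm) integral_nonneg_eq_0_iff_AE) auto
      then have "AE x in K. f x * indicator B (X x) = 0" by auto
      then show ?thesis by (rule integral_eq_zero_AE)
    qed
    then show ?thesis using True c_def cN iM iN by simp
  next
    case False
    have "c \<ge> 0" unfolding c_def using f by (intro Bochner_Integration.integral_nonneg) auto
    with False have c: "c > 0" by simp
    define D where "D K = distr (density K (\<lambda>x. ennreal (f x / c))) borel X" for K :: "'a measure"
    have dist: "real_distribution (D K)"
      if fm: "f \<in> borel_measurable K" "X \<in> borel_measurable K" and i: "integrable K f" "(\<integral>x. f x \<partial>K) = c" for K
    proof -
      note [measurable] = fm
      have "emeasure (density K (\<lambda>x. ennreal (f x / c))) (space K) = (\<integral>\<^sup>+x. ennreal (f x / c) \<partial>K)"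
        by (simp add: emeasure_density cong: nn_integral_cong)
      also have "\<dots> = ennreal (\<integral>x. f x / c \<partial>K)"
        using i c f by (intro nn_integral_eq_integral) auto
      also have "\<dots> = 1" using i c by simp
      finally have "prob_space (density K (\<lambda>x. ennreal (f x / c)))"
        by (intro prob_spaceI) simp
      then interpret prob_space "density K (\<lambda>x. ennreal (f x / c))" .
      show ?thesis unfolding D_def by (intro real_distribution_distr) simp
    qed
    have chr: "char (D K) t = (CLINT x|K. f x * iexp (t * X x)) / c"
      if fm: "f \<in> borel_measurable K" "X \<in> borel_measurable K" for K t
    proof -
      note [measurable] = fm
      have "char (D K) t = (CLINT x|density K (\<lambda>x. ennreal (f x / c)). iexp (t * X x))"
        unfolding char_def D_def by (subst integral_distr) auto
      also have "\<dots> = (CLINT x|K. (f x / c) *\<^sub>R iexp (t * X x))"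
        using f c by (subst integral_density) auto
      also have "\<dots> = (CLINT x|K. (f x * iexp (t * X x)) / c)"
        by (intro Bochner_Integration.integral_cong refl) (simp add: scaleR_conv_of_real)
      finally show ?thesis by simp
    qed
    have "char (D M) = char (D N)"
      using chr[OF fM] chr[OF fN] eq by (intro ext) simp
    then have DD: "D M = D N"
      using dist[OF fM iM] dist[OF fN iN] cN c_def by (intro Levy_uniqueness) auto
    have ind: "(\<integral>x. f x * indicator B (X x) \<partial>K) = c * (\<integral>x. indicator B x \<partial>D K)"
      if fm: "f \<in> borel_measurable K" "X \<in> borel_measurable K" for K
    proof -
      note [measurable] = fm B
      have "(\<integral>x. indicator B x \<partial>D K) = (\<integral>x. indicator B (X x) \<partial>density K (\<lambda>x. ennreal (f x / c)) :: real)"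
        unfolding D_def by (subst integral_distr) auto
      also have "\<dots> = (\<integral>x. (f x / c) *\<^sub>R indicator B (X x) \<partial>K)"
        using f c by (subst integral_density) auto
      also have "\<dots> = (\<integral>x. f x * indicator B (X x) / c \<partial>K)"
        by (intro Bochner_Integration.integral_cong refl) simp
      finally show ?thesis using c by simp
    qed
    show ?thesis unfolding ind[OF fM] ind[OF fN] DD ..
  qed
qed

text \<open>Induction over the coordinates. Uniqueness on the line needs positive densities, so the
  character \<open>exp (i u x)\<close> of the remaining coordinates is replaced by the functions
  \<open>1 + cos (u x + a)\<close>, whose span contains its real and imaginary parts.\<close>
lemma char_box_eq:
  fixes M N :: "'a::euclidean_space measure"
  assumes "prob_space M" "prob_space N" and sM: "sets M = sets borel" and sN: "sets N = sets borel"
    and eq: "\<And>u. (CLINT x|M. iexp (u \<bullet> x)) = (CLINT x|N. iexp (u \<bullet> x))"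
    and "finite I" and B: "\<And>b. B b \<in> sets (borel :: real measure)"
  shows "(CLINT x|M. iexp (u \<bullet> x) * of_real (\<Prod>b\<in>I. indicator (B b) (x \<bullet> b))) =
         (CLINT x|N. iexp (u \<bullet> x) * of_real (\<Prod>b\<in>I. indicator (B b) (x \<bullet> b)))"
  using \<open>finite I\<close>
proof (induction I arbitrary: u rule: finite_induct)
  case empty
  then show ?case using eq by simp
next
  case (insert j I)
  note [measurable] = B
  interpret M: prob_space M by fact
  interpret N: prob_space N by fact
  note mM = measurable_cong_sets[OF sM refl] and mN = measurable_cong_sets[OF sN refl]
  define w where "w x = (\<Prod>b\<in>I. indicator (B b) (x \<bullet> b) :: real)" for x :: 'a
  have w: "0 \<le> w x" "w x \<le> 1" for x
    unfolding w_def by (auto intro!: prod_nonneg prod_le_1 simp: indicator_def)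
  have [measurable]: "w \<in> borel_measurable borel"
    unfolding w_def by measurable
  have IH: "(CLINT x|M. iexp (u \<bullet> x) * w x) = (CLINT x|N. iexp (u \<bullet> x) * w x)" for u
    using insert.IH[of u] by (simp add: w_def)
  have int: "integrable M (\<lambda>x. iexp (u \<bullet> x) * w x)" "integrable N (\<lambda>x. iexp (u \<bullet> x) * w x)" for u
    using w by (auto intro!: M.integrable_const_bound[where B=1] N.integrable_const_bound[where B=1]
      simp: mM mN norm_mult)
  have lin: "(CLINT x|K. p x + a * q x + b * r x) = (CLINT x|K. p x) + a * (CLINT x|K. q x) + b * (CLINT x|K. r x)"
    if "integrable K p" "integrable K q" "integrable K r" for K :: "'a measure" and p q r and a b :: complex
    using that by simp
  \<comment> \<open>The cosine is half the sum of two characters, so the product is a combination of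
    characters at \<open>t *\<^sub>R j\<close>, \<open>t *\<^sub>R j + u\<close> and
    \<open>t *\<^sub>R j - u\<close>, to each of which the induction hypothesis applies.\<close>
  have trig: "complex_of_real ((1 + cos (u \<bullet> x + a)) * w x) * iexp (t * (x \<bullet> j)) =
      iexp ((t *\<^sub>R j) \<bullet> x) * w x + (iexp a / 2) * (iexp ((t *\<^sub>R j + u) \<bullet> x) * w x)
       + (iexp (-a) / 2) * (iexp ((t *\<^sub>R j - u) \<bullet> x) * w x)" for t a x u
  proof -
    have "complex_of_real (cos (u \<bullet> x + a)) = (iexp (u \<bullet> x + a) + iexp (- (u \<bullet> x + a))) / 2"
      by (simp add: cos_of_real[symmetric] cos_exp_eq algebra_simps)
    then show ?thesis
      by (simp add: inner_diff_left inner_add_left inner_commute[of j x] exp_add exp_diff exp_minus algebra_simps add_divide_distrib)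
  qed
  have key: "(\<integral>x. ((1 + cos (u \<bullet> x + a)) * w x) * indicator (B j) (x \<bullet> j) \<partial>M) =
      (\<integral>x. ((1 + cos (u \<bullet> x + a)) * w x) * indicator (B j) (x \<bullet> j) \<partial>N)" for u a
  proof (rule integral_indicator_eqI_char[where C=2])
    show "0 \<le> (1 + cos (u \<bullet> x + a)) * w x" for x
      using w[of x] cos_ge_minus_one[of "u \<bullet> x + a"] by (intro mult_nonneg_nonneg) linarith+
    show "(1 + cos (u \<bullet> x + a)) * w x \<le> 2" for x
      using mult_mono[of "1 + cos (u \<bullet> x + a)" 2 "w x" 1] w[of x] cos_le_one[of "u \<bullet> x + a"] by auto
    show "(CLINT x|M. complex_of_real ((1 + cos (u \<bullet> x + a)) * w x) * iexp (t * (x \<bullet> j))) =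
      (CLINT x|N. complex_of_real ((1 + cos (u \<bullet> x + a)) * w x) * iexp (t * (x \<bullet> j)))" for t
      unfolding trig by (simp only: lin[OF int(1) int(1) int(1)] lin[OF int(2) int(2) int(2)] IH)
  qed (use M.finite_measure_axioms N.finite_measure_axioms in \<open>auto simp: mM mN B\<close>)
  define w' where "w' x = w x * indicator (B j) (x \<bullet> j)" for x
  have w': "0 \<le> w' x" "w' x \<le> 1" for x
    unfolding w'_def using w[of x] by (auto simp: indicator_def)
  have [measurable]: "w' \<in> borel_measurable borel"
    unfolding w'_def by measurable
  have ci: "integrable M (\<lambda>x. cos (u \<bullet> x + a) * w' x)" "integrable N (\<lambda>x. cos (u \<bullet> x + a) * w' x)" for u a
    using w' by (auto intro!: M.integrable_const_bound[where B=1] N.integrable_const_bound[where B=1]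
      AE_I2 mult_le_one simp: mM mN abs_mult)
  have wi: "integrable M w'" "integrable N w'"
    using ci[of 0 0] by auto
  have key': "(\<integral>x. w' x \<partial>M) + (\<integral>x. cos (u \<bullet> x + a) * w' x \<partial>M) =
      (\<integral>x. w' x \<partial>N) + (\<integral>x. cos (u \<bullet> x + a) * w' x \<partial>N)" for u a
    using key[of u a] ci wi
    by (simp add: w'_def[symmetric] distrib_right mult.assoc)
  \<comment> \<open>At \<open>u = 0\<close>, \<open>a = 0\<close> the cosine is 1 and
    \<open>key'\<close> compares twice the mass of \<open>w'\<close>; subtracting this mass then
    isolates the cosine part.\<close>
  have "(\<integral>x. w' x \<partial>M) = (\<integral>x. w' x \<partial>N)"
    using key'[of 0 0] by simp
  then have cs: "(\<integral>x. cos (u \<bullet> x + a) * w' x \<partial>M) = (\<integral>x. cos (u \<bullet> x + a) * w' x \<partial>N)" for u a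
    using key'[of u a] by simp
  \<comment> \<open>The phase \<open>-pi/2\<close> turns the cosine into the sine, which supplies
    the imaginary part of the character.\<close>
  have dec: "iexp (u \<bullet> x) * of_real (\<Prod>b\<in>insert j I. indicator (B b) (x \<bullet> b)) =
      of_real (cos (u \<bullet> x + 0) * w' x) + \<i> * of_real (cos (u \<bullet> x + (-pi/2)) * w' x)" for x
  proof -
    have "cos (u \<bullet> x + (-pi/2)) = sin (u \<bullet> x)"
      by (simp add: cos_diff)
    then show ?thesis
      using insert.hyps
      by (simp add: w'_def w_def exp_Euler cos_of_real sin_of_real algebra_simps)
  qed
  show ?case
    unfolding dec
    using lin[OF integrable_of_real[OF ci(1)[of u 0]] integrable_of_real[OF ci(1)[of u "-pi/2"]] integrable_zero, of \<i> 0]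
      lin[OF integrable_of_real[OF ci(2)[of u 0]] integrable_of_real[OF ci(2)[of u "-pi/2"]] integrable_zero, of \<i> 0]
    by (simp only: integral_complex_of_real cs cs[of u 0, unfolded add_0_right] mult_zero_left add_0_right)
qed

text \<open>Open boxes form an intersection-stable generator, and at frequency 0 the preceding
  identity compares exactly the measures of boxes.\<close>

theorem char_uniqueness_euclidean:
  fixes M N :: "'a::euclidean_space measure"
  assumes "prob_space M" "prob_space N" and sM: "sets M = sets borel" and sN: "sets N = sets borel"
    and eq: "\<And>u. (CLINT x|M. iexp (u \<bullet> x)) = (CLINT x|N. iexp (u \<bullet> x))"
  shows "M = N"
proof (rule measure_eqI_generator_eq)
  let ?E = "range (\<lambda>(a, b). box a b::'a set)"
  interpret M: prob_space M by fact
  interpret N: prob_space N by fact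
  show "Int_stable ?E"
    by (auto simp: Int_stable_def box_Int_box)
  show "?E \<subseteq> Pow UNIV" "sets M = sigma_sets UNIV ?E" "sets N = sigma_sets UNIV ?E"
    by (simp_all add: borel_eq_box sM sN)
  let ?A = "\<lambda>n::nat. box (- (real n *\<^sub>R One)) (real n *\<^sub>R One) :: 'a set"
  show "range ?A \<subseteq> ?E" "(\<Union>i. ?A i) = UNIV"
    unfolding UN_box_eq_UNIV by auto
  show "emeasure M (?A i) \<noteq> \<infinity>" for i by simp
  fix X assume "X \<in> ?E"
  then obtain a b where X: "X = box a b" by auto
  have ind: "(\<Prod>k\<in>Basis. indicator {a \<bullet> k <..< b \<bullet> k} (x \<bullet> k)) = (indicator X x :: real)" for x
    unfolding X by (auto simp: box_def indicator_def prod_zero_iff)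
  have "complex_of_real (measure M X) = of_real (measure N X)"
    using char_box_eq[OF assms finite_Basis, of "\<lambda>k. {a \<bullet> k <..< b \<bullet> k}" 0]
    unfolding ind by (simp add: integral_complex_of_real X sM sN)
  then show "emeasure M X = emeasure N X"
    by (simp add: M.emeasure_eq_measure N.emeasure_eq_measure)
qed

section \<open>Gaussian variables and vectors\<close>

text \<open>Variance 0 is a point mass without a density and needs its own case; otherwise scaling
  by \<open>sqrt q\<close> reduces to the standard normal law.\<close>

lemma gaussian_rv_char:
  assumes "prob_space M" "gaussian_rv M X 0 q"
  shows "char (distr M borel X) t = of_real (exp (- (q * t\<^sup>2) / 2))"
proof -
  interpret prob_space M by fact
  have X[measurable]: "X \<in> borel_measurable M" and q: "q \<ge> 0"
    using assms(2) by (auto simp: gaussian_rv_def)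
  show ?thesis
  proof (cases "q = 0")
    case True
    then have "distr M borel X = return borel 0"
      using assms(2) by (simp add: gaussian_rv_def)
    then show ?thesis using True by (simp add: char_def integral_return)
  next
    case False
    with q have q: "sqrt q > 0" by simp
    have "distributed M lborel X (normal_density 0 (sqrt q))"
      using False assms(2) by (simp add: gaussian_rv_def)
    then have "distributed M lborel (\<lambda>x. (X x - 0) / sqrt q) std_normal_density"
      using q by (subst normal_standard_normal_convert[symmetric]) auto
    then have Z: "distr M lborel (\<lambda>x. X x / sqrt q) = std_normal_distribution"
      by (simp add: distributed_def)
    have "char (distr M borel X) t = (CLINT x|M. iexp ((t * sqrt q) * (X x / sqrt q)))"
      using q by (simp add: char_def integral_distr)
    also have "\<dots> = char (distr M lborel (\<lambda>x. X x / sqrt q)) (t * sqrt q)"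
      unfolding char_def by (subst integral_distr) auto
    also have "\<dots> = of_real (exp (- (t * sqrt q)\<^sup>2 / 2))"
      unfolding Z by (simp add: char_std_normal_distribution)
    finally show ?thesis using \<open>q \<ge> 0\<close> by (simp add: power_mult_distrib mult.commute)
  qed
qed

text \<open>Levy uniqueness recovers the law. In this form the sum of two independent Gaussian parts
  is recognised as Gaussian, even when both are degenerate.\<close>

lemma gaussian_rvI_char:
  assumes "prob_space M" and X[measurable]: "X \<in> borel_measurable M" and q: "0 \<le> q"
    and char: "\<And>t. char (distr M borel X) t = of_real (exp (- (q * t\<^sup>2) / 2))"
  shows "gaussian_rv M X 0 q"
proof -
  interpret prob_space M by fact
  show ?thesis
  proof (cases "q = 0")
    case True
    have "distr M borel X = return borel 0"
    proof (rule Levy_uniqueness)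
      show "real_distribution (return borel (0::real))"
        by (auto simp: real_distribution_def real_distribution_axioms_def intro!: prob_space_return)
      show "char (distr M borel X) = char (return borel 0)"
        using True char by (auto simp: fun_eq_iff char_def[of "return _ _"] integral_return)
    qed (rule real_distribution_distr, simp)
    then show ?thesis using True by (simp add: gaussian_rv_def)
  next
    case False
    with q have q: "sqrt q > 0" by simp
    have "distr M borel (\<lambda>x. X x / sqrt q) = std_normal_distribution"
    proof (rule Levy_uniqueness)
      show "char (distr M borel (\<lambda>x. X x / sqrt q)) = char std_normal_distribution"
      proof
        fix t
        have "char (distr M borel (\<lambda>x. X x / sqrt q)) t = (CLINT x|M. iexp ((t / sqrt q) * X x))"
          by (simp add: char_def integral_distr)
        also have "\<dots> = char (distr M borel X) (t / sqrt q)"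
          by (simp add: char_def integral_distr)
        finally show "char (distr M borel (\<lambda>x. X x / sqrt q)) t = char std_normal_distribution t"
          using q by (simp add: char char_std_normal_distribution power_divide)
      qed
    qed (auto intro!: real_distribution_distr real_dist_normal_dist)
    then have "distributed M lborel (\<lambda>x. (X x - 0) / sqrt q) std_normal_density"
      unfolding distributed_def by (simp cong: distr_cong)
    then have "distributed M lborel X (normal_density 0 (sqrt q))"
      using q by (subst normal_standard_normal_convert) auto
    then show ?thesis using False \<open>0 \<le> q\<close> by (simp add: gaussian_rv_def)
  qed
qed

lemma gaussian_rv_moments:
  assumes "prob_space M" "gaussian_rv M X 0 q"
  shows "integrable M X" "(\<integral>x. X x \<partial>M) = 0" "integrable M (\<lambda>x. (X x)\<^sup>2)" "(\<integral>x. (X x)\<^sup>2 \<partial>M) = q"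
proof -
  interpret prob_space M by fact
  have X[measurable]: "X \<in> borel_measurable M" and q: "q \<ge> 0"
    using assms(2) by (auto simp: gaussian_rv_def)
  have "integrable M X \<and> (\<integral>x. X x \<partial>M) = 0 \<and> integrable M (\<lambda>x. (X x)\<^sup>2) \<and> (\<integral>x. (X x)\<^sup>2 \<partial>M) = q"
  proof (cases "q = 0")
    case True
    then have D: "distr M borel X = return borel 0"
      using assms(2) by (simp add: gaussian_rv_def)
    have "AE x in distr M borel X. x = 0" unfolding D by (simp add: AE_return)
    then have "AE x in M. X x = 0" by (simp add: AE_distr_iff)
    then have 1: "AE x in M. X x = 0" "AE x in M. (X x)\<^sup>2 = 0" by auto
    have "integrable M X \<longleftrightarrow> integrable M (\<lambda>_. 0 :: real)"
      "integrable M (\<lambda>x. (X x)\<^sup>2) \<longleftrightarrow> integrable M (\<lambda>_. 0 :: real)"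
      using 1 by (intro integrable_cong_AE; simp)+
    then show ?thesis using 1 True by (simp add: integral_eq_zero_AE)
  next
    case False
    with q have q: "sqrt q > 0" by simp
    have D: "distributed M lborel X (normal_density 0 (sqrt q))"
      using False assms(2) by (simp add: gaussian_rv_def)
    have "integrable M X"
      using distributed_integrable[OF D, of "\<lambda>x. x"] integrable_normal_moment[OF q, of 0 1] by simp
    moreover have "integrable M (\<lambda>x. (X x)\<^sup>2)"
      using distributed_integrable[OF D, of "\<lambda>x. x\<^sup>2"] integrable_normal_moment[OF q, of 0 2] by simp
    moreover have "(\<integral>x. X x \<partial>M) = 0"
      using normal_distributed_expectation[OF q D] .
    moreover have "(\<integral>x. (X x)\<^sup>2 \<partial>M) = q"
      using normal_distributed_variance[OF q D] \<open>(\<integral>x. X x \<partial>M) = 0\<close> \<open>q \<ge> 0\<close> by simp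
    ultimately show ?thesis by simp
  qed
  then show "integrable M X" "(\<integral>x. X x \<partial>M) = 0" "integrable M (\<lambda>x. (X x)\<^sup>2)" "(\<integral>x. (X x)\<^sup>2 \<partial>M) = q"
    by auto
qed

lemma prod_std_normal_density:
  fixes x :: "'a::euclidean_space"
  shows "(\<Prod>b\<in>Basis. std_normal_density (x \<bullet> b)) = (1 / sqrt (2 * pi)) ^ DIM('a) * exp (- (x \<bullet> x) / 2)"
proof -
  have "(\<Prod>b\<in>Basis. exp (- (x \<bullet> b)\<^sup>2 / 2)) = exp (\<Sum>b\<in>Basis. - (x \<bullet> b)\<^sup>2 / 2)"
    by (simp add: exp_sum)
  also have "(\<Sum>b\<in>Basis. - (x \<bullet> b)\<^sup>2 / 2) = - (x \<bullet> x) / 2"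
    unfolding euclidean_inner[of x x] by (simp add: power2_eq_square sum_negf sum_divide_distrib)
  finally show ?thesis
    unfolding std_normal_density_def prod.distrib by simp
qed

definition std_gaussian :: "'a::euclidean_space measure" where
  "std_gaussian = density lborel (\<lambda>x. ennreal (\<Prod>b\<in>Basis. std_normal_density (x \<bullet> b)))"

lemma prob_space_std_gaussian: "prob_space (std_gaussian :: 'a::euclidean_space measure)"
proof (rule prob_spaceI)
  have 1: "(\<integral>\<^sup>+x. ennreal (std_normal_density x) \<partial>lborel) = 1"
    by (subst nn_integral_eq_integral) auto
  have "emeasure (std_gaussian :: 'a measure) UNIV
    = (\<integral>\<^sup>+x. (\<Prod>b\<in>Basis. ennreal (std_normal_density ((x::'a) \<bullet> b))) \<partial>lborel)"
    unfolding std_gaussian_def by (subst emeasure_density) (auto simp: prod_ennreal)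
  also have "\<dots> = 1"
    by (subst nn_integral_lborel_prod) (auto simp: 1)
  finally show "emeasure (std_gaussian :: 'a measure) (space std_gaussian) = 1"
    by (simp add: std_gaussian_def)
qed

text \<open>Density and character both factor over the coordinates, so Fubini leaves a product of
  one-dimensional characteristic functions.\<close>

lemma std_gaussian_char:
  fixes u :: "'a::euclidean_space"
  shows "(CLINT x|std_gaussian. iexp (u \<bullet> x)) = of_real (exp (- (u \<bullet> u) / 2))"
proof -
  interpret product_sigma_finite "\<lambda>_::'a. lborel :: real measure" ..
  define f where "f b x = std_normal_density x *\<^sub>R iexp ((u \<bullet> b) * x)" for b x
  have [measurable]: "f b \<in> borel_measurable borel" for b unfolding f_def by measurable
  have f_int: "integrable lborel (f b)" for b
    by (rule Bochner_Integration.integrable_bound[OF integrable_normal_density[of 1 0]])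
      (auto simp: f_def)
  have f_val: "(\<integral>x. f b x \<partial>lborel) = of_real (exp (- (u \<bullet> b)\<^sup>2 / 2))" for b
  proof -
    have "char std_normal_distribution (u \<bullet> b) = (\<integral>x. f b x \<partial>lborel)"
      unfolding char_def f_def by (subst integral_density) auto
    then show ?thesis by (simp add: char_std_normal_distribution)
  qed
  have "(CLINT x|std_gaussian. iexp (u \<bullet> x)) =
    (\<integral>x. (\<Prod>b\<in>Basis. std_normal_density (x \<bullet> b)) *\<^sub>R iexp (u \<bullet> x) \<partial>lborel)"
    unfolding std_gaussian_def by (subst integral_density) (auto intro!: prod_nonneg)
  also have "\<dots> = (\<integral>x. (\<Prod>b\<in>Basis. f b (x \<bullet> b)) \<partial>lborel)"
  proof (intro Bochner_Integration.integral_cong refl)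
    fix x :: 'a
    have "iexp (u \<bullet> x) = (\<Prod>b\<in>Basis. iexp ((u \<bullet> b) * (x \<bullet> b)))"
      unfolding euclidean_inner[of u x] by (simp add: exp_sum sum_distrib_left)
    then show "(\<Prod>b\<in>Basis. std_normal_density (x \<bullet> b)) *\<^sub>R iexp (u \<bullet> x) = (\<Prod>b\<in>Basis. f b (x \<bullet> b))"
      by (simp add: f_def scaleR_conv_of_real prod.distrib)
  qed
  also have "\<dots> = (\<integral>y. (\<Prod>b\<in>Basis. f b (y b)) \<partial>(\<Pi>\<^sub>M b\<in>Basis. lborel))"
    by (subst lborel_eq, subst integral_distr) (auto cong: prod.cong)
  also have "\<dots> = (\<Prod>b\<in>Basis. \<integral>x. f b x \<partial>lborel)"
    using f_int by (intro product_integral_prod) auto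
  also have "\<dots> = of_real (\<Prod>b\<in>Basis. exp (- (u \<bullet> b)\<^sup>2 / 2))"
    unfolding f_val by simp
  also have "(\<Prod>b\<in>Basis. exp (- (u \<bullet> b)\<^sup>2 / 2)) = exp (- (u \<bullet> u) / 2)"
    unfolding euclidean_inner[of u u]
    by (simp add: exp_sum[symmetric] power2_eq_square sum_negf sum_divide_distrib)
  finally show ?thesis .
qed

section \<open>Matrix algebra, linear images of Lebesgue measure and Gaussian densities\<close>

lemma inner_transpose_mult:
  fixes A :: "real^'n^'m"
  shows "(transpose A *v x) \<bullet> y = x \<bullet> (A *v y)"
  by (simp add: dot_lmul_matrix)

lemma matrix_inv_left: "invertible A \<Longrightarrow> matrix_inv A ** A = mat 1"
  and matrix_inv_right: "invertible A \<Longrightarrow> A ** matrix_inv A = mat 1"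
  unfolding invertible_def matrix_inv_def by (metis (mono_tags, lifting) someI_ex)+

lemma matrix_inv_uniqueI:
  fixes A :: "real^'n^'n"
  assumes "B ** A = mat 1"
  shows "matrix_inv A = B"
proof -
  have "A ** B = mat 1" using assms by (simp add: matrix_left_right_inverse)
  then have "invertible A" using assms by (auto simp: invertible_def)
  then have "A ** matrix_inv A = mat 1" by (rule matrix_inv_right)
  then have "B ** (A ** matrix_inv A) = B" by simp
  then show ?thesis using assms by (simp add: matrix_mul_assoc)
qed

text \<open>Gram-Schmidt for the inner product \<open>x \<bullet> (A *v y)\<close>; the columns of
  \<open>B\<close> are an orthonormal basis for it.\<close>

lemma pos_def_congruent_mat_1:
  fixes A :: "real^'n^'n"
  assumes sym: "transpose A = A" and pos: "\<And>x. x \<noteq> 0 \<Longrightarrow> 0 < x \<bullet> (A *v x)"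
  shows "\<exists>B::real^'n^'n. transpose B ** A ** B = mat 1"
proof -
  have swap: "x \<bullet> (A *v y) = y \<bullet> (A *v x)" for x y
    using inner_transpose_mult[of A x y] sym by (simp add: inner_commute)
  have "k \<le> CARD('n) \<Longrightarrow> \<exists>b::nat \<Rightarrow> real^'n. \<forall>i<k. \<forall>j<k. b i \<bullet> (A *v b j) = (if i = j then 1 else 0)" for k
  proof (induction k)
    case (Suc k)
    then obtain b :: "nat \<Rightarrow> real^'n"
      where b: "\<And>i j. i < k \<Longrightarrow> j < k \<Longrightarrow> b i \<bullet> (A *v b j) = (if i = j then 1 else 0)"
      by (meson Suc_leD)
    \<comment> \<open>The \<open>k\<close> images \<open>A *v b i\<close> cannot span the space, so
      some nonzero \<open>x\<close> is orthogonal to all of them, which is orthogonality to the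
      \<open>b i\<close> in the form of \<open>A\<close>.\<close>
    have "dim ((\<lambda>i. A *v b i) ` {..<k}) \<le> card ((\<lambda>i. A *v b i) ` {..<k})"
      by (intro dim_le_card') simp
    also have "\<dots> \<le> k" using card_image_le[of "{..<k}"] by simp
    also have "\<dots> < DIM(real^'n)" using Suc.prems by simp
    finally obtain x where "x \<noteq> 0"
      and x: "\<And>y. y \<in> span ((\<lambda>i. A *v b i) ` {..<k}) \<Longrightarrow> orthogonal x y"
      using orthogonal_to_subspace_exists by blast
    define y where "y = (1 / sqrt (x \<bullet> (A *v x))) *\<^sub>R x"
    have xb: "x \<bullet> (A *v b i) = 0" if "i < k" for i
      using x[of "A *v b i"] that by (auto simp: orthogonal_def intro: span_base)
    have yb: "y \<bullet> (A *v b i) = 0" "b i \<bullet> (A *v y) = 0" if "i < k" for i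
      using xb[OF that] swap[of "b i" y] by (auto simp: y_def)
    have yy: "y \<bullet> (A *v y) = 1"
      using pos[OF \<open>x \<noteq> 0\<close>] by (simp add: y_def matrix_vector_mult_scaleR field_simps)
    show ?case
      by (rule exI[of _ "b(k := y)"]) (auto simp: b yb yy less_Suc_eq)
  qed simp
  then obtain b :: "nat \<Rightarrow> real^'n"
    where b: "\<And>i j. i < CARD('n) \<Longrightarrow> j < CARD('n) \<Longrightarrow> b i \<bullet> (A *v b j) = (if i = j then 1 else 0)"
    by blast
  obtain f :: "'n \<Rightarrow> nat" where f: "bij_betw f UNIV {0..<CARD('n)}"
    using ex_bij_betw_finite_nat[of "UNIV :: 'n set"] by auto
  then have f_lt: "f i < CARD('n)" and f_eq: "f i = f j \<longleftrightarrow> i = j" for i j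
    by (auto simp: bij_betw_def inj_on_def)
  define B :: "real^'n^'n" where "B = (\<chi> r c. b (f c) $ r)"
  have col: "B *v axis i 1 = b (f i)" for i
    unfolding matrix_vector_mult_basis by (simp add: B_def column_def)
  have "(transpose B ** A ** B) $ i $ j = mat 1 $ i $ j" for i j
  proof -
    have "(transpose B ** A ** B) $ i $ j = ((transpose B ** A ** B) *v axis j 1) \<bullet> axis i 1"
      by (simp add: matrix_vector_mult_basis column_def inner_axis)
    also have "\<dots> = (transpose B *v (A *v (B *v axis j 1))) \<bullet> axis i 1"
      by (simp add: matrix_vector_mul_assoc matrix_mul_assoc)
    also have "\<dots> = (A *v b (f j)) \<bullet> b (f i)"
      unfolding inner_transpose_mult col ..
    also have "\<dots> = mat 1 $ i $ j"
      using b[OF f_lt f_lt, of i j] f_eq by (simp add: inner_commute mat_def)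
    finally show ?thesis .
  qed
  then have "transpose B ** A ** B = mat 1" by (simp add: vec_eq_iff)
  then show ?thesis ..
qed

text \<open>Fubini applied to \<open>f x * g (x + y)\<close> under \<open>N \<Otimes> lborel\<close> exchanges the roles of the two measures.\<close>
lemma translation_invariant_eq_scaled_lborel:
  fixes N :: "'a::euclidean_space measure"
  assumes sN[measurable_cong]: "sets N = sets borel" and "sigma_finite_measure N"
    and inv: "\<And>c. distr N borel ((+) c) = N"
  shows "N = density lborel (\<lambda>_. emeasure N (box 0 One))"
proof -
  interpret N: sigma_finite_measure N by fact
  interpret NL: pair_sigma_finite N "lborel :: 'a measure" ..
  have spN: "space N = UNIV" using sets_eq_imp_space_eq[OF sN] by simp
  have trN: "(\<integral>\<^sup>+x. f (c + x) \<partial>N) = (\<integral>\<^sup>+x. f x \<partial>N)" if [measurable]: "f \<in> borel_measurable borel" for f c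
    by (subst (2) inv[of c, symmetric]) (simp add: nn_integral_distr)
  have trL: "(\<integral>\<^sup>+x. f (c + x) \<partial>lborel) = (\<integral>\<^sup>+x. f x \<partial>lborel)"
    if [measurable]: "f \<in> borel_measurable borel" for f and c :: 'a
    by (subst (2) lborel_distr_plus[of c, symmetric]) (simp add: nn_integral_distr)
  have reL: "(\<integral>\<^sup>+y. f (x - y) \<partial>lborel) = (\<integral>\<^sup>+y. f y \<partial>lborel)"
    if [measurable]: "f \<in> borel_measurable borel" for f and x :: 'a
    by (subst (2) lborel_affine[of "-1" x]) (auto simp: nn_integral_density nn_integral_distr density_1)
  have swap: "(\<integral>\<^sup>+x. f x \<partial>N) * (\<integral>\<^sup>+y. g y \<partial>lborel) = (\<integral>\<^sup>+x. g x \<partial>N) * (\<integral>\<^sup>+y. f y \<partial>lborel)"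
    if [measurable]: "f \<in> borel_measurable borel" "g \<in> borel_measurable borel" for f g :: "'a \<Rightarrow> ennreal"
  proof -
    have "(\<integral>\<^sup>+x. f x \<partial>N) * (\<integral>\<^sup>+y. g y \<partial>lborel) = (\<integral>\<^sup>+x. (\<integral>\<^sup>+y. f x * g (x + y) \<partial>lborel) \<partial>N)"
      by (simp add: nn_integral_cmult trL nn_integral_multc)
    also have "\<dots> = (\<integral>\<^sup>+y. (\<integral>\<^sup>+x. f x * g (x + y) \<partial>N) \<partial>lborel)"
      by (rule NL.Fubini'[symmetric]) measurable
    \<comment> \<open>Invariance of \<open>N\<close> moves the shift from \<open>g\<close> to
      \<open>f\<close>; after the next exchange the Lebesgue integral of \<open>f (x - y)\<close>
      over \<open>y\<close> no longer depends on \<open>x\<close>.\<close>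
    also have "\<dots> = (\<integral>\<^sup>+y. (\<integral>\<^sup>+x. f (x - y) * g x \<partial>N) \<partial>lborel)"
    proof (rule nn_integral_cong)
      fix y :: 'a
      show "(\<integral>\<^sup>+x. f x * g (x + y) \<partial>N) = (\<integral>\<^sup>+x. f (x - y) * g x \<partial>N)"
        using trN[of "\<lambda>x. f (x - y) * g x" y] by (simp add: add.commute)
    qed
    also have "\<dots> = (\<integral>\<^sup>+x. (\<integral>\<^sup>+y. f (x - y) * g x \<partial>lborel) \<partial>N)"
      by (rule NL.Fubini') measurable
    also have "\<dots> = (\<integral>\<^sup>+x. g x \<partial>N) * (\<integral>\<^sup>+y. f y \<partial>lborel)"
      by (simp add: nn_integral_multc reL nn_integral_cmult mult.commute)
    finally show ?thesis .
  qed
  have unit: "emeasure lborel (box 0 One :: 'a set) = 1"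
    by (subst emeasure_lborel_box) (auto simp: inner_diff_left)
  show ?thesis
  proof (rule measure_eqI)
    fix X assume "X \<in> sets N"
    then have X[measurable]: "X \<in> sets borel" by (simp add: sN)
    \<comment> \<open>Testing against the unit box, of Lebesgue measure 1, determines the
      factor.\<close>
    show "emeasure N X = emeasure (density lborel (\<lambda>_. emeasure N (box 0 One))) X"
      using swap[of "indicator X" "indicator (box 0 One)"]
      by (simp add: unit emeasure_density nn_integral_cmult_indicator sN)
  qed (simp add: sN)
qed

text \<open>A shift of the image comes from a shift of the argument, so the image measure is
  translation invariant and a multiple of Lebesgue measure. No determinant is computed: it is enough
  that the factor is finite and positive.\<close>

lemma distr_lborel_matrix:
  fixes A :: "real^'n^'n"
  assumes A: "invertible A"
  shows "\<exists>c>0. distr lborel borel ((*v) A) = density lborel (\<lambda>_. ennreal c)"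
proof -
  have cont[measurable]: "(*v) Q \<in> borel_measurable borel" for Q :: "real^'n^'n"
    by (intro borel_measurable_continuous_onI matrix_vector_mult_linear_continuous_on)
  have inv1: "matrix_inv A ** A = mat 1" "A ** matrix_inv A = mat 1"
    using A by (simp_all add: matrix_inv_left matrix_inv_right)
  define N where "N = distr lborel borel ((*v) A)"
  have sN: "sets N = sets borel" by (simp add: N_def)
  \<comment> \<open>Mapping back by the inverse recovers \<open>lborel\<close>, whose
    sigma-finiteness transfers to \<open>N\<close>.\<close>
  have "sigma_finite_measure (distr N borel ((*v) (matrix_inv A)))"
  proof -
    have "distr N borel ((*v) (matrix_inv A)) = lborel"
      unfolding N_def by (subst distr_distr) (auto simp: comp_def matrix_vector_mul_assoc inv1 distr_id2)
    then show ?thesis by (simp add: lborel.sigma_finite_measure_axioms)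
  qed
  then have sf: "sigma_finite_measure N"
    by (rule sigma_finite_measure_distr) (simp add: N_def)
  have tr: "distr N borel ((+) c) = N" for c
  proof -
    have "c + A *v x = A *v (matrix_inv A *v c + x)" for x
      by (simp add: matrix_vector_right_distrib matrix_vector_mul_assoc inv1)
    then have "distr N borel ((+) c) = distr (distr lborel borel ((+) (matrix_inv A *v c))) borel ((*v) A)"
      unfolding N_def by (simp add: distr_distr comp_def)
    then show ?thesis by (simp add: lborel_distr_plus N_def)
  qed
  define e where "e = emeasure N (box 0 One)"
  have N: "N = density lborel (\<lambda>_. e)"
    unfolding e_def by (rule translation_invariant_eq_scaled_lborel[OF sN sf tr])
  have "(*v) A -` box 0 One \<subseteq> (*v) (matrix_inv A) ` box 0 One"
  proof
    fix x assume "x \<in> (*v) A -` box 0 One"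
    moreover have "x = matrix_inv A *v (A *v x)" by (simp add: matrix_vector_mul_assoc inv1)
    ultimately show "x \<in> (*v) (matrix_inv A) ` box 0 One" by blast
  qed
  then have "bounded ((*v) A -` box 0 One)"
    by (rule bounded_subset[rotated]) (intro bounded_linear_image bounded_box matrix_vector_mul_bounded_linear)
  \<comment> \<open>The preimage of the unit box under an invertible matrix is bounded, hence of
    finite measure.\<close>
  then have "e < \<infinity>"
    unfolding e_def N_def by (simp add: emeasure_distr emeasure_bounded_finite[unfolded infinity_ennreal_def])
  moreover have "e \<noteq> 0"
  proof
    assume "e = 0"
    then have "emeasure N UNIV = 0" unfolding N by (simp add: emeasure_density)
    moreover have "emeasure N UNIV = emeasure lborel (UNIV :: (real^'n) set)"
      unfolding N_def by (subst emeasure_distr) auto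
    ultimately show False by simp
  qed
  ultimately have "e = ennreal (enn2real e)" "enn2real e > 0"
    by (simp_all add: enn2real_positive_iff less_top zero_less_iff_neq_zero)
  then show ?thesis using N unfolding N_def by metis
qed

text \<open>Whitening: if \<open>transpose B ** A ** B = mat 1\<close>, then
  \<open>transpose B *v X x\<close> has the standard Gaussian characteristic function, hence that
  law, and mapping back gives the density. The same congruence yields
  \<open>matrix_inv A = B ** transpose B\<close>, which produces the exponent.\<close>

lemma gaussian_vector_density:
  fixes X :: "'a \<Rightarrow> real^'n" and A :: "real^'n^'n"
  assumes "prob_space M" and X[measurable]: "X \<in> borel_measurable M"
    and char: "\<And>u. (CLINT x|M. iexp (u \<bullet> X x)) = of_real (exp (- (u \<bullet> (A *v u)) / 2))"
    and sym: "transpose A = A" and pos: "\<And>x. x \<noteq> 0 \<Longrightarrow> 0 < x \<bullet> (A *v x)"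
  shows "\<exists>C>0. distr M borel X = density lborel (\<lambda>z. ennreal (C * exp (- (z \<bullet> (matrix_inv A *v z)) / 2)))"
proof -
  interpret prob_space M by fact
  obtain B :: "real^'n^'n" where B: "transpose B ** A ** B = mat 1"
    using pos_def_congruent_mat_1[OF sym pos] by auto
  have invB: "invertible B"
    using B by (auto simp: invertible_left_inverse)
  have B': "B ** (transpose B ** A) = mat 1"
    using B by (simp add: matrix_left_right_inverse)
  have K: "matrix_inv A = B ** transpose B"
    using B' by (intro matrix_inv_uniqueI) (simp add: matrix_mul_assoc)
  have invT: "invertible (transpose B)" using invB by (rule transpose_invertible)
  define L where "L = matrix_inv (transpose B)"
  have L: "transpose B ** L = mat 1" "L ** transpose B = mat 1"
    using invT by (simp_all add: L_def matrix_inv_left matrix_inv_right)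
  have invL: "invertible L" using L by (auto simp: invertible_def)
  have cont[measurable]: "(*v) Q \<in> borel_measurable borel" for Q :: "real^'n^'n"
    by (intro borel_measurable_continuous_onI matrix_vector_mult_linear_continuous_on)
  define Y where "Y x = transpose B *v X x" for x
  have [measurable]: "Y \<in> borel_measurable M" unfolding Y_def by measurable
  have Y: "distr M borel Y = std_gaussian"
  proof (rule char_uniqueness_euclidean)
    show "prob_space (distr M borel Y)" by (rule prob_space_distr) simp
    show "prob_space (std_gaussian :: (real^'n) measure)" by (rule prob_space_std_gaussian)
    show "sets (std_gaussian :: (real^'n) measure) = sets borel" by (simp add: std_gaussian_def)
    fix u :: "real^'n"
    have uY: "u \<bullet> Y x = (B *v u) \<bullet> X x" for x
      using inner_transpose_mult[of B "X x" u] by (simp add: Y_def inner_commute)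
    have uu: "(B *v u) \<bullet> (A *v (B *v u)) = u \<bullet> u"
    proof -
      have "(B *v u) \<bullet> (A *v (B *v u)) = (transpose B *v (A *v (B *v u))) \<bullet> u"
        unfolding inner_transpose_mult by (rule inner_commute)
      also have "transpose B *v (A *v (B *v u)) = u"
        using B by (simp only: matrix_vector_mul_assoc matrix_mul_assoc matrix_vector_mul_lid)
      finally show ?thesis .
    qed
    have "(CLINT x|distr M borel Y. iexp (u \<bullet> x)) = (CLINT x|M. iexp (u \<bullet> Y x))"
      by (subst integral_distr) auto
    also have "\<dots> = of_real (exp (- (u \<bullet> u) / 2))"
      unfolding uY char uu ..
    finally show "(CLINT x|distr M borel Y. iexp (u \<bullet> x)) = (CLINT x|std_gaussian. iexp (u \<bullet> x))"
      by (simp only: std_gaussian_char)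
  qed simp
  define g where "g x = (\<Prod>b\<in>Basis. std_normal_density (x \<bullet> b))" for x :: "real^'n"
  have [measurable]: "g \<in> borel_measurable borel" unfolding g_def by measurable
  have g0: "0 \<le> g x" for x unfolding g_def by (auto intro!: prod_nonneg)
  have X_eq: "X x = L *v Y x" for x
    unfolding Y_def by (simp only: matrix_vector_mul_assoc L matrix_vector_mul_lid)
  have gB: "g (transpose B *v (L *v x)) = g x" for x
    by (simp only: matrix_vector_mul_assoc L matrix_vector_mul_lid)
  obtain c where c: "c > 0" "distr lborel borel ((*v) L) = density lborel (\<lambda>_. ennreal c)"
    using distr_lborel_matrix[OF invL] by auto
  have "distr M borel X = distr (distr M borel Y) borel ((*v) L)"
    by (subst distr_distr) (auto simp: comp_def X_eq[symmetric])
  also have "\<dots> = distr (density lborel (\<lambda>x. ennreal (g (transpose B *v (L *v x))))) borel ((*v) L)"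
    unfolding Y std_gaussian_def g_def[symmetric] gB ..
  also have "\<dots> = density (distr lborel borel ((*v) L)) (\<lambda>x. ennreal (g (transpose B *v x)))"
    by (subst density_distr) (auto simp del: transpose_matrix_vector)
  also have "\<dots> = density lborel (\<lambda>x. ennreal (c * g (transpose B *v x)))"
    unfolding c(2) using c(1) by (subst density_density_eq) (auto simp: ennreal_mult[symmetric] g0 simp del: transpose_matrix_vector)
  also have "\<dots> = density lborel (\<lambda>x. ennreal ((c * (1 / sqrt (2 * pi)) ^ CARD('n)) *
      exp (- (x \<bullet> (matrix_inv A *v x)) / 2)))"
  proof -
    have "(transpose B *v x) \<bullet> (transpose B *v x) = x \<bullet> (matrix_inv A *v x)" for x
      unfolding inner_transpose_mult K by (simp only: matrix_vector_mul_assoc)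
    then show ?thesis
      unfolding g_def prod_std_normal_density by (simp add: mult.assoc)
  qed
  finally show ?thesis
    using c(1) by (intro exI[of _ "c * (1 / sqrt (2 * pi)) ^ CARD('n)"]) simp
qed

section \<open>Translations of a Gaussian law\<close>

lemma borel_measurable_matrix_vector_mult [measurable]:
  "(\<lambda>x. (Q :: real^'n^'m) *v x) \<in> borel_measurable borel"
  by (intro borel_measurable_continuous_onI matrix_vector_mult_linear_continuous_on)

text \<open>\<open>P\<close> is the law of the centred noise vector, \<open>V\<close> its covariance
  and \<open>K\<close> the inverse. The moments are assumed because they come from the
  one-dimensional marginals and not from integrating the density; of \<open>C\<close> only
  positivity is recorded, as it cancels in likelihood ratios.\<close>

locale gaussian_law =
  fixes P :: "(real^'n) measure" and K V :: "real^'n^'n" and C :: real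
  assumes P_eq: "P = density lborel (\<lambda>z. ennreal (C * exp (- (z \<bullet> (K *v z)) / 2)))"
    and C_pos: "0 < C" and P_prob: "prob_space P"
    and K_sym: "transpose K = K" and VK: "V ** K = mat 1"
    and integrable_inner: "\<And>a. integrable P (\<lambda>z. z \<bullet> a)"
    and integral_inner: "\<And>a. (\<integral>z. z \<bullet> a \<partial>P) = 0"
    and integrable_inner_square: "\<And>a. integrable P (\<lambda>z. (z \<bullet> a)\<^sup>2)"
    and integral_inner_square: "\<And>a. (\<integral>z. (z \<bullet> a)\<^sup>2 \<partial>P) = a \<bullet> (V *v a)"
begin

sublocale prob_space P by (rule P_prob)

lemma sets_P [measurable_cong, simp]: "sets P = sets borel"
  by (simp add: P_eq)

lemma space_P [simp]: "space P = UNIV"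
  by (simp add: P_eq)

lemma K_swap: "x \<bullet> (K *v y) = y \<bullet> (K *v x)"
  using inner_transpose_mult[of K x y] K_sym by (simp add: inner_commute)

lemma integral_score_square: "(\<integral>z. (z \<bullet> (K *v a))\<^sup>2 \<partial>P) = a \<bullet> (K *v a)"
proof -
  have "V *v (K *v a) = a" by (simp add: matrix_vector_mul_assoc VK)
  then show ?thesis by (simp add: integral_inner_square inner_commute)
qed

lemma K_nonneg: "0 \<le> a \<bullet> (K *v a)"
  unfolding integral_score_square[symmetric] by (intro Bochner_Integration.integral_nonneg) simp

lemma integrable_inner_mult: "integrable P (\<lambda>z. (z \<bullet> a) * (z \<bullet> b))"
  by (intro integrable_mult_of_square integrable_inner_square) auto

lemma integral_score_mult: "(\<integral>z. (z \<bullet> (K *v a)) * (z \<bullet> (K *v b)) \<partial>P) = a \<bullet> (K *v b)"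
proof -
  \<comment> \<open>Polarisation reduces mixed moments to variances.\<close>
  have "(z \<bullet> (K *v a)) * (z \<bullet> (K *v b)) =
      ((z \<bullet> (K *v (a + b)))\<^sup>2 - (z \<bullet> (K *v a))\<^sup>2 - (z \<bullet> (K *v b))\<^sup>2) / 2" for z
    by (simp add: matrix_vector_right_distrib inner_add_right power2_eq_square algebra_simps)
  then have "(\<integral>z. (z \<bullet> (K *v a)) * (z \<bullet> (K *v b)) \<partial>P) =
    ((a + b) \<bullet> (K *v (a + b)) - a \<bullet> (K *v a) - b \<bullet> (K *v b)) / 2"
    unfolding integral_score_square[symmetric]
    by (simp only: integral_divide_zero Bochner_Integration.integral_diff integrable_inner_square
        Bochner_Integration.integrable_diff)
  also have "\<dots> = a \<bullet> (K *v b)"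
    using K_swap[of a b] by (simp add: matrix_vector_right_distrib inner_add_right inner_add_left)
  finally show ?thesis .
qed

text \<open>The Radon-Nikodym derivative of \<open>P\<close> translated by \<open>m\<close> with
  respect to \<open>P\<close>, in Cameron-Martin form; the subtracted term comes from completing the
  square.\<close>

definition likelihood_ratio :: "real^'n \<Rightarrow> real^'n \<Rightarrow> real" where
  "likelihood_ratio m z = exp (z \<bullet> (K *v m) - (m \<bullet> (K *v m)) / 2)"

lemma likelihood_ratio_measurable [measurable]: "likelihood_ratio m \<in> borel_measurable borel"
  unfolding likelihood_ratio_def by measurable

lemma likelihood_ratio_pos: "0 < likelihood_ratio m z"
  by (simp add: likelihood_ratio_def)

lemma distr_translate:
  "distr P borel (\<lambda>z. m + z) = density lborel (\<lambda>z. ennreal (C * exp (- ((z - m) \<bullet> (K *v (z - m))) / 2)))"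
proof -
  have "distr P borel (\<lambda>z. m + z) =
    distr (density lborel (\<lambda>z. ennreal (C * exp (- (((m + z) - m) \<bullet> (K *v ((m + z) - m))) / 2)))) borel (\<lambda>z. m + z)"
    unfolding P_eq by simp
  also have "\<dots> = density (distr lborel borel ((+) m)) (\<lambda>z. ennreal (C * exp (- ((z - m) \<bullet> (K *v (z - m))) / 2)))"
    by (subst density_distr) auto
  finally show ?thesis by (simp add: lborel_distr_plus)
qed

lemma distr_translate_likelihood_ratio:
  "distr P borel (\<lambda>z. m + z) = density P (\<lambda>z. ennreal (likelihood_ratio m z))"
proof -
  have eq: "C * exp (- (z \<bullet> (K *v z)) / 2) * likelihood_ratio m z = C * exp (- ((z - m) \<bullet> (K *v (z - m))) / 2)" for z
  proof -
    have "- (z \<bullet> (K *v z)) / 2 + (z \<bullet> (K *v m) - (m \<bullet> (K *v m)) / 2) = - ((z - m) \<bullet> (K *v (z - m))) / 2"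
      using K_swap[of m z] by (simp add: matrix_vector_mult_diff_distrib inner_diff_left inner_diff_right field_simps)
    then show ?thesis unfolding likelihood_ratio_def mult.assoc exp_add[symmetric] by simp
  qed
  show ?thesis
    unfolding distr_translate eq[symmetric] unfolding P_eq using C_pos
    by (subst density_density_eq) (auto simp: ennreal_mult[symmetric] less_imp_le[OF likelihood_ratio_pos])
qed

lemma
  fixes G :: "real^'n \<Rightarrow> real"
  assumes [measurable]: "G \<in> borel_measurable borel"
  shows integrable_translate: "integrable P (\<lambda>z. G (m + z)) \<longleftrightarrow> integrable P (\<lambda>z. likelihood_ratio m z * G z)"
    and integral_translate: "(\<integral>z. G (m + z) \<partial>P) = (\<integral>z. likelihood_ratio m z * G z \<partial>P)"
proof -
  have pos: "AE z in P. 0 \<le> likelihood_ratio m z" by (simp add: less_imp_le[OF likelihood_ratio_pos])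
  have "integrable P (\<lambda>z. G (m + z)) \<longleftrightarrow> integrable (distr P borel (\<lambda>z. m + z)) G"
    by (subst integrable_distr_eq) auto
  also have "\<dots> \<longleftrightarrow> integrable P (\<lambda>z. likelihood_ratio m z * G z)"
    unfolding distr_translate_likelihood_ratio using pos by (subst integrable_density) auto
  finally show "integrable P (\<lambda>z. G (m + z)) \<longleftrightarrow> integrable P (\<lambda>z. likelihood_ratio m z * G z)" .
  have "(\<integral>z. G (m + z) \<partial>P) = integral\<^sup>L (distr P borel (\<lambda>z. m + z)) G"
    by (subst integral_distr) auto
  also have "\<dots> = (\<integral>z. likelihood_ratio m z * G z \<partial>P)"
    unfolding distr_translate_likelihood_ratio using pos by (subst integral_density) auto
  finally show "(\<integral>z. G (m + z) \<partial>P) = (\<integral>z. likelihood_ratio m z * G z \<partial>P)" .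
qed

text \<open>All moments come from the translation identity: \<open>likelihood_ratio m (m + z)\<close> equals
  \<open>exp (q m) * likelihood_ratio m z\<close>.\<close>
lemma
  defines "q \<equiv> \<lambda>m. m \<bullet> (K *v m)"
  shows integrable_likelihood_ratio_square: "integrable P (\<lambda>z. (likelihood_ratio m z)\<^sup>2)"
    and integrable_linearization_square: "integrable P (\<lambda>z. (likelihood_ratio m z - 1 - z \<bullet> (K *v m))\<^sup>2)"
    and integral_linearization_square:
      "(\<integral>z. (likelihood_ratio m z - 1 - z \<bullet> (K *v m))\<^sup>2 \<partial>P) = exp (q m) - 1 - q m"
proof -
  let ?L = "likelihood_ratio m" and ?z = "\<lambda>z. z \<bullet> (K *v m)"
  \<comment> \<open>The translation identity is applied in turn to 1, to the score and to the
    likelihood ratio itself, once for each kind of term in the expanded square that contains the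
    likelihood ratio.\<close>
  have L1: "integrable P ?L" "(\<integral>z. ?L z \<partial>P) = 1"
    using integrable_translate[of "\<lambda>_. 1" m] integral_translate[of "\<lambda>_. 1" m] prob_space by simp_all
  have L2: "integrable P (\<lambda>z. ?L z * ?z z)" "(\<integral>z. ?L z * ?z z \<partial>P) = q m"
    using integrable_translate[of ?z m] integral_translate[of ?z m] prob_space
    by (simp_all add: inner_add_left integrable_inner integral_inner q_def)
  have sh: "?L (m + z) = exp (q m) * ?L z" for z
    by (simp add: likelihood_ratio_def q_def inner_add_left exp_add[symmetric])
  have L3: "integrable P (\<lambda>z. (?L z)\<^sup>2)" "(\<integral>z. (?L z)\<^sup>2 \<partial>P) = exp (q m)"
    using integrable_translate[of ?L m] integral_translate[of ?L m] L1
    by (simp_all add: sh power2_eq_square)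
  show "integrable P (\<lambda>z. (?L z)\<^sup>2)" by fact
  have eq: "(?L z - 1 - ?z z)\<^sup>2 = (?L z)\<^sup>2 + 1 + (?z z)\<^sup>2 - 2 * ?L z - 2 * (?L z * ?z z) + 2 * ?z z" for z
    by (simp add: power2_eq_square algebra_simps)
  show "integrable P (\<lambda>z. (?L z - 1 - ?z z)\<^sup>2)"
    unfolding eq using L1 L2 L3 by (simp add: integrable_inner integrable_inner_square)
  show "(\<integral>z. (?L z - 1 - ?z z)\<^sup>2 \<partial>P) = exp (q m) - 1 - q m"
    unfolding eq using L1 L2 L3 prob_space
    by (simp add: integrable_inner integrable_inner_square integral_inner integral_score_square q_def)
qed

text \<open>Differentiates the mean of \<open>F\<close> along a path of shifts. A path and not a
  line is taken because the sampled mean need not be affine in the parameter; only its tangent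
  \<open>a\<close> at 0 survives in the limit.\<close>

lemma integral_mult_score:
  fixes F :: "real^'n \<Rightarrow> real" and m :: "real \<Rightarrow> real^'n"
  assumes F[measurable]: "F \<in> borel_measurable borel" and F2: "integrable P (\<lambda>z. (F z)\<^sup>2)"
    and m: "((\<lambda>t. (1 / t) *\<^sub>R m t) \<longlongrightarrow> a) (at 0)"
    and r: "((\<lambda>t. ((\<integral>z. F (m t + z) \<partial>P) - (\<integral>z. F z \<partial>P)) / t) \<longlongrightarrow> r) (at 0)"
  shows "(\<integral>z. F z * (z \<bullet> (K *v a)) \<partial>P) = r"
proof -
  define q where "q t = m t \<bullet> (K *v m t)" for t
  define b where "b t = (1 / t) *\<^sub>R m t - a" for t
  \<comment> \<open>The difference quotient of the likelihood ratio minus the limiting score, split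
    into the linearisation error of the shift \<open>m t\<close> and the deviation
    \<open>b t\<close> of the path from its tangent.\<close>
  define R where "R t z = (1 / t) * (likelihood_ratio (m t) z - 1 - z \<bullet> (K *v m t)) + z \<bullet> (K *v b t)" for t z
  define E where "E t = ((\<integral>z. F (m t + z) \<partial>P) - (\<integral>z. F z \<partial>P)) / t - (\<integral>z. F z * (z \<bullet> (K *v a)) \<partial>P)" for t
  have mm[measurable]: "R t \<in> borel_measurable borel" for t
    unfolding R_def by measurable
  have F1: "integrable P F"
    using integrable_mult_of_square[OF _ _ F2, of "\<lambda>_. 1"] by simp
  have Fs: "integrable P (\<lambda>z. F z * (z \<bullet> a))" for a
    by (intro integrable_mult_of_square F2 integrable_inner_square) auto
  have FL: "integrable P (\<lambda>z. likelihood_ratio m z * F z)" for m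
    by (intro integrable_mult_of_square F2 integrable_likelihood_ratio_square) auto
  have E_eq: "E t = (\<integral>z. F z * R t z \<partial>P)" if "t \<noteq> 0" for t
  proof -
    have "F z * R t z = (1 / t) * (likelihood_ratio (m t) z * F z - F z) - F z * (z \<bullet> (K *v a))" for z
      using that by (simp add: R_def b_def matrix_vector_mult_diff_distrib matrix_vector_mult_scaleR
        inner_diff_right field_simps)
    then show ?thesis
      using FL F1 Fs by (simp add: E_def integral_translate)
  qed
  have R2: "integrable P (\<lambda>z. (R t z)\<^sup>2)"
    and R2_le: "(\<integral>z. (R t z)\<^sup>2 \<partial>P) \<le> 2 * ((exp (q t) - 1 - q t) / t\<^sup>2) + 2 * (b t \<bullet> (K *v b t))" for t
  proof -
    let ?S = "\<lambda>z. 2 * ((1 / t)\<^sup>2 * (likelihood_ratio (m t) z - 1 - z \<bullet> (K *v m t))\<^sup>2) + 2 * (z \<bullet> (K *v b t))\<^sup>2"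
    have iS: "integrable P ?S"
      by (intro Bochner_Integration.integrable_add integrable_mult_right integrable_linearization_square
          integrable_inner_square)
    have le: "(R t z)\<^sup>2 \<le> ?S z" for z
      using sum_squares_bound[of "(1 / t) * (likelihood_ratio (m t) z - 1 - z \<bullet> (K *v m t))" "z \<bullet> (K *v b t)"]
      unfolding R_def power2_sum power_mult_distrib by linarith
    show i: "integrable P (\<lambda>z. (R t z)\<^sup>2)"
      by (rule Bochner_Integration.integrable_bound[OF iS]) (use le in \<open>auto intro!: AE_I2 order_trans[OF le]\<close>)
    have "(\<integral>z. (R t z)\<^sup>2 \<partial>P) \<le> (\<integral>z. ?S z \<partial>P)"
      by (intro integral_mono i iS le)
    also have "\<dots> = 2 * ((exp (q t) - 1 - q t) / t\<^sup>2) + 2 * (b t \<bullet> (K *v b t))"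
      using integrable_linearization_square[of "m t"] integrable_inner_square[of "K *v b t"]
      by (simp add: integral_linearization_square integral_score_square q_def power_divide)
    finally show "(\<integral>z. (R t z)\<^sup>2 \<partial>P) \<le> 2 * ((exp (q t) - 1 - q t) / t\<^sup>2) + 2 * (b t \<bullet> (K *v b t))" .
  qed
  have E2_le: "(E t)\<^sup>2 \<le> (\<integral>z. (F z)\<^sup>2 \<partial>P) * (2 * ((exp (q t) - 1 - q t) / t\<^sup>2) + 2 * (b t \<bullet> (K *v b t)))"
    if "t \<noteq> 0" for t
  proof -
    have "(E t)\<^sup>2 \<le> (\<integral>z. (F z)\<^sup>2 \<partial>P) * (\<integral>z. (R t z)\<^sup>2 \<partial>P)"
      unfolding E_eq[OF that] by (intro integral_Cauchy_Schwarz F2 R2) auto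
    also have "\<dots> \<le> (\<integral>z. (F z)\<^sup>2 \<partial>P) * (2 * ((exp (q t) - 1 - q t) / t\<^sup>2) + 2 * (b t \<bullet> (K *v b t)))"
      by (intro mult_left_mono R2_le Bochner_Integration.integral_nonneg) simp
    finally show ?thesis .
  qed
  have Klim: "((\<lambda>t. K *v f t) \<longlongrightarrow> K *v l) G" if "(f \<longlongrightarrow> l) G" for f l and G :: "real filter"
    using that by (rule bounded_linear.tendsto[OF matrix_vector_mul_bounded_linear])
  have blim: "(b \<longlongrightarrow> 0) (at 0)"
    unfolding b_def using tendsto_diff[OF m tendsto_const[of a]] by simp
  have bK: "((\<lambda>t. b t \<bullet> (K *v b t)) \<longlongrightarrow> 0) (at 0)"
    using tendsto_inner[OF blim Klim[OF blim]] by simp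
  have mlim: "(m \<longlongrightarrow> 0) (at 0)"
  proof -
    have "((\<lambda>t. t *\<^sub>R ((1 / t) *\<^sub>R m t)) \<longlongrightarrow> 0 *\<^sub>R a) (at 0)"
      by (intro tendsto_scaleR m tendsto_ident_at)
    moreover have "eventually (\<lambda>t::real. t *\<^sub>R ((1 / t) *\<^sub>R m t) = m t) (at 0)"
      by (auto simp: eventually_at_filter)
    ultimately show ?thesis by (simp add: tendsto_cong)
  qed
  have qlim: "(q \<longlongrightarrow> 0) (at 0)"
    unfolding q_def using tendsto_inner[OF mlim Klim[OF mlim]] by simp
  \<comment> \<open>One factor \<open>m t\<close> absorbs the division by \<open>t\<close>, the
    other tends to 0.\<close>
  have qt: "((\<lambda>t. q t / t) \<longlongrightarrow> 0) (at 0)"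
    using tendsto_inner[OF m Klim[OF mlim]] by (simp add: q_def)
  \<comment> \<open>For \<open>0 \<le> q t \<le> 1\<close> the second-order remainder of
    \<open>exp\<close> is at most \<open>(q t)\<^sup>2\<close>, so the quotient is bounded by the
    square of \<open>q t / t\<close>.\<close>
  have "((\<lambda>t. (exp (q t) - 1 - q t) / t\<^sup>2) \<longlongrightarrow> 0) (at 0)"
  proof (rule tendsto_sandwich[where f="\<lambda>_. 0" and h="\<lambda>t. (q t / t)\<^sup>2"])
    show "((\<lambda>t. (q t / t)\<^sup>2) \<longlongrightarrow> 0) (at 0)"
      using tendsto_power[OF qt, of 2] by simp
    show "\<forall>\<^sub>F t in at 0. 0 \<le> (exp (q t) - 1 - q t) / t\<^sup>2"
      using exp_ge_add_one_self by (intro always_eventually) (auto simp: algebra_simps)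
    have "\<forall>\<^sub>F t in at 0. q t < 1" using qlim by (rule order_tendstoD) simp
    then show "\<forall>\<^sub>F t in at 0. (exp (q t) - 1 - q t) / t\<^sup>2 \<le> (q t / t)\<^sup>2"
    proof eventually_elim
      case (elim t)
      have "exp (q t) \<le> 1 + q t + (q t)\<^sup>2"
        using elim K_nonneg by (intro exp_bound) (auto simp: q_def)
      then show ?case
        unfolding power_divide by (intro divide_right_mono) auto
    qed
  qed simp
  then have "((\<lambda>t. (\<integral>z. (F z)\<^sup>2 \<partial>P) * (2 * ((exp (q t) - 1 - q t) / t\<^sup>2) + 2 * (b t \<bullet> (K *v b t)))) \<longlongrightarrow>
      (\<integral>z. (F z)\<^sup>2 \<partial>P) * (2 * 0 + 2 * 0)) (at 0)"
    by (intro tendsto_intros bK)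
  then have lim: "((\<lambda>t. (\<integral>z. (F z)\<^sup>2 \<partial>P) * (2 * ((exp (q t) - 1 - q t) / t\<^sup>2) + 2 * (b t \<bullet> (K *v b t)))) \<longlongrightarrow> 0) (at 0)"
    by simp
  have "((\<lambda>t. (E t)\<^sup>2) \<longlongrightarrow> 0) (at 0)"
  proof (rule tendsto_sandwich[OF _ _ tendsto_const lim])
    show "\<forall>\<^sub>F t in at 0. (E t)\<^sup>2 \<le> (\<integral>z. (F z)\<^sup>2 \<partial>P) * (2 * ((exp (q t) - 1 - q t) / t\<^sup>2) + 2 * (b t \<bullet> (K *v b t)))"
      using eventually_neq_at_within[of 0] by (rule eventually_mono) (rule E2_le)
  qed simp
  then have "(E \<longlongrightarrow> 0) (at 0)"
    using tendsto_real_sqrt[of "\<lambda>t. (E t)\<^sup>2" 0 "at 0"] by (simp add: tendsto_rabs_zero_iff)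
  moreover have "(E \<longlongrightarrow> r - (\<integral>z. F z * (z \<bullet> (K *v a)) \<partial>P)) (at 0)"
    unfolding E_def by (intro tendsto_diff r tendsto_const)
  ultimately show ?thesis
    using tendsto_unique[OF at_neq_bot] by force
qed

end

section \<open>Fisher information\<close>

lemma has_derivative_imp_directional_tendsto:
  fixes f :: "'a::real_normed_vector \<Rightarrow> 'b::real_normed_vector"
  assumes f: "(f has_derivative f') (at x)"
  shows "((\<lambda>t. (1 / t) *\<^sub>R (f (x + t *\<^sub>R v) - f x)) \<longlongrightarrow> f' v) (at 0)"
proof -
  have "((\<lambda>t. x + t *\<^sub>R v) has_derivative (\<lambda>t. t *\<^sub>R v)) (at 0)"
    by (auto intro!: derivative_eq_intros)
  then have "((\<lambda>t. f (x + t *\<^sub>R v)) has_derivative (\<lambda>t. f' (t *\<^sub>R v))) (at 0)"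
    using has_derivative_compose[of "\<lambda>t. x + t *\<^sub>R v" "\<lambda>t. t *\<^sub>R v" 0 UNIV f f'] f by simp
  moreover have "(\<lambda>t. f' (t *\<^sub>R v)) = (\<lambda>t. t *\<^sub>R f' v)"
    using has_derivative_bounded_linear[OF f] by (auto simp: linear_simps)
  ultimately have "((\<lambda>t. norm (f (x + t *\<^sub>R v) - f x - t *\<^sub>R f' v) / norm t) \<longlongrightarrow> 0) (at 0)"
    by (simp add: has_derivative_iff_norm)
  moreover have "\<forall>\<^sub>F t in at 0. norm (f (x + t *\<^sub>R v) - f x - t *\<^sub>R f' v) / norm t =
      norm ((1 / t) *\<^sub>R (f (x + t *\<^sub>R v) - f x) - f' v)"
    using eventually_neq_at_within[of 0]
  proof (rule eventually_mono)
    fix t :: real assume "t \<noteq> 0"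
    then have "(1 / t) *\<^sub>R (f (x + t *\<^sub>R v) - f x) - f' v = (1 / t) *\<^sub>R (f (x + t *\<^sub>R v) - f x - t *\<^sub>R f' v)"
      by (simp add: scaleR_diff_right)
    then show "norm (f (x + t *\<^sub>R v) - f x - t *\<^sub>R f' v) / norm t =
      norm ((1 / t) *\<^sub>R (f (x + t *\<^sub>R v) - f x) - f' v)"
      by simp
  qed
  ultimately have "((\<lambda>t. norm ((1 / t) *\<^sub>R (f (x + t *\<^sub>R v) - f x) - f' v)) \<longlongrightarrow> 0) (at 0)"
    by (rule Lim_transform_eventually)
  then show ?thesis
    by (rule LIM_zero_cancel[OF tendsto_norm_zero_cancel])
qed

text \<open>The densities at different parameters may be altered on different null sets, so equality
  of the scores is read off along a sequence of parameters converging to \<open>\<theta>\<close>.\<close>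
lemma is_fisher_information_unique:
  fixes P :: "real^'k::finite \<Rightarrow> (real^'n::finite) measure"
  assumes "open \<Theta>" "\<theta> \<in> \<Theta>" and 1: "is_fisher_information P \<Theta> \<theta> J\<^sub>1" and 2: "is_fisher_information P \<Theta> \<theta> J\<^sub>2"
  shows "J\<^sub>1 = J\<^sub>2"
proof -
  define D where "D p z i = frechet_derivative (\<lambda>\<theta>'. ln (p \<theta>' z)) (at \<theta>) (axis i 1)"
    for p :: "real^'k \<Rightarrow> real^'n \<Rightarrow> real" and z i
  obtain p where p0: "(\<lambda>(\<theta>', z). p \<theta>' z) \<in> borel_measurable borel \<and>
      (\<forall>\<theta>'\<in>\<Theta>. (\<forall>z. p \<theta>' z \<ge> 0) \<and> P \<theta>' = density lborel (\<lambda>z. ennreal (p \<theta>' z))) \<and>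
      (AE z in P \<theta>. p \<theta> z > 0 \<and> (\<lambda>\<theta>'. ln (p \<theta>' z)) differentiable (at \<theta>)) \<and>
      (\<forall>i j. integrable (P \<theta>) (\<lambda>z. D p z i * D p z j)) \<and>
      J\<^sub>1 = (\<chi> i j. \<integral>z. D p z i * D p z j \<partial>P \<theta>)"
    using 1 unfolding is_fisher_information_def D_def by (rule exE)
  have p: "(\<lambda>(\<theta>', z). p \<theta>' z) \<in> borel_measurable borel"
     "\<And>\<theta>' z. \<theta>' \<in> \<Theta> \<Longrightarrow> p \<theta>' z \<ge> 0" "\<And>\<theta>'. \<theta>' \<in> \<Theta> \<Longrightarrow> P \<theta>' = density lborel (\<lambda>z. ennreal (p \<theta>' z))"
     "AE z in P \<theta>. p \<theta> z > 0 \<and> (\<lambda>\<theta>'. ln (p \<theta>' z)) differentiable (at \<theta>)"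
     "\<And>i j. integrable (P \<theta>) (\<lambda>z. D p z i * D p z j)" "J\<^sub>1 = (\<chi> i j. \<integral>z. D p z i * D p z j \<partial>P \<theta>)"
    using p0 by blast+
  obtain q where q0: "(\<lambda>(\<theta>', z). q \<theta>' z) \<in> borel_measurable borel \<and>
      (\<forall>\<theta>'\<in>\<Theta>. (\<forall>z. q \<theta>' z \<ge> 0) \<and> P \<theta>' = density lborel (\<lambda>z. ennreal (q \<theta>' z))) \<and>
      (AE z in P \<theta>. q \<theta> z > 0 \<and> (\<lambda>\<theta>'. ln (q \<theta>' z)) differentiable (at \<theta>)) \<and>
      (\<forall>i j. integrable (P \<theta>) (\<lambda>z. D q z i * D q z j)) \<and>
      J\<^sub>2 = (\<chi> i j. \<integral>z. D q z i * D q z j \<partial>P \<theta>)"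
    using 2 unfolding is_fisher_information_def D_def by (rule exE)
  have q: "(\<lambda>(\<theta>', z). q \<theta>' z) \<in> borel_measurable borel"
     "\<And>\<theta>' z. \<theta>' \<in> \<Theta> \<Longrightarrow> q \<theta>' z \<ge> 0" "\<And>\<theta>'. \<theta>' \<in> \<Theta> \<Longrightarrow> P \<theta>' = density lborel (\<lambda>z. ennreal (q \<theta>' z))"
     "AE z in P \<theta>. q \<theta> z > 0 \<and> (\<lambda>\<theta>'. ln (q \<theta>' z)) differentiable (at \<theta>)"
     "\<And>i j. integrable (P \<theta>) (\<lambda>z. D q z i * D q z j)" "J\<^sub>2 = (\<chi> i j. \<integral>z. D q z i * D q z j \<partial>P \<theta>)"
    using q0 by blast+
  have [measurable]: "p \<theta>' \<in> borel_measurable borel" "q \<theta>' \<in> borel_measurable borel" for \<theta>'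
  proof -
    have "(\<lambda>z. (\<theta>', z)) \<in> measurable (borel :: (real^'n) measure) borel" by simp
    from measurable_compose[OF this p(1)] measurable_compose[OF this q(1)]
    show "p \<theta>' \<in> borel_measurable borel" "q \<theta>' \<in> borel_measurable borel" by simp_all
  qed
  have AE_eq: "AE z in P \<theta>. p \<theta>' z = q \<theta>' z" if "\<theta>' \<in> \<Theta>" for \<theta>'
  proof -
    have "density lborel (\<lambda>z. ennreal (p \<theta>' z)) = density lborel (\<lambda>z. ennreal (q \<theta>' z))"
      using p(3)[OF that] q(3)[OF that] by simp
    then have "AE z in lborel. ennreal (p \<theta>' z) = ennreal (q \<theta>' z)"
      by (intro sigma_finite_measure.density_unique[OF sigma_finite_lborel]) auto
    then have "AE z in lborel. p \<theta>' z = q \<theta>' z"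
      by eventually_elim (use p(2)[OF that] q(2)[OF that] in simp)
    then show ?thesis
      unfolding p(3)[OF \<open>\<theta> \<in> \<Theta>\<close>] by (subst AE_density) auto
  qed
  obtain e where e: "e > 0" "ball \<theta> e \<subseteq> \<Theta>" using assms(1,2) openE by blast
  \<comment> \<open>Half the radius keeps every shifted parameter in \<open>\<Theta>\<close>, and
    the steps are nonzero, so difference quotients along them converge to the partial
    derivatives.\<close>
  define r where "r n = (e / 2) * inverse (real (Suc n))" for n
  have r: "r \<longlonglongrightarrow> 0" "\<And>n. r n \<noteq> 0"
    unfolding r_def by (rule tendsto_mult_right_zero[OF LIMSEQ_inverse_real_of_nat]) (use e(1) in simp)
  have r'': "filterlim r (at 0) sequentially"
    using r by (auto simp: filterlim_at)
  have r': "\<theta> + r n *\<^sub>R axis i 1 \<in> \<Theta>" for n i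
  proof -
    have "\<bar>r n\<bar> < e" using e(1) by (simp add: r_def field_simps add_pos_nonneg)
    then show ?thesis using e(2) by (auto simp: subset_iff dist_norm)
  qed
  \<comment> \<open>The exceptional null sets are countable in number, so their union is
    null.\<close>
  have "AE z in P \<theta>. \<forall>n. \<forall>i\<in>UNIV. p (\<theta> + r n *\<^sub>R axis i 1) z = q (\<theta> + r n *\<^sub>R axis i 1) z"
    unfolding AE_all_countable by (intro allI AE_finite_allI AE_eq r') simp
  with p(4) q(4) AE_eq[OF \<open>\<theta> \<in> \<Theta>\<close>] have D_eq: "AE z in P \<theta>. \<forall>i. D p z i = D q z i"
  proof eventually_elim
    case (elim z)
    show ?case
    proof
      fix i
      have "(\<lambda>n. (1 / r n) *\<^sub>R (ln (p (\<theta> + r n *\<^sub>R axis i 1) z) - ln (p \<theta> z))) \<longlonglongrightarrow> D p z i"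
        unfolding D_def using elim
        by (intro filterlim_compose[OF has_derivative_imp_directional_tendsto r'']) (simp flip: frechet_derivative_works)
      moreover have "(\<lambda>n. (1 / r n) *\<^sub>R (ln (q (\<theta> + r n *\<^sub>R axis i 1) z) - ln (q \<theta> z))) \<longlonglongrightarrow> D q z i"
        unfolding D_def using elim
        by (intro filterlim_compose[OF has_derivative_imp_directional_tendsto r'']) (simp flip: frechet_derivative_works)
      ultimately show "D p z i = D q z i"
        using elim by (simp add: LIMSEQ_unique)
    qed
  qed
  have "(\<integral>z. D p z i * D p z j \<partial>P \<theta>) = (\<integral>z. D q z i * D q z j \<partial>P \<theta>)" for i j
    using D_eq by (intro integral_cong_AE borel_measurable_integrable[OF p(5)] borel_measurable_integrable[OF q(5)])
      (auto elim: eventually_mono)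
  then show ?thesis unfolding p(6) q(6) by simp
qed

text \<open>The explicit Gaussian densities serve as witnesses; after taking logarithms the constant
  disappears from the derivative, and the score is linear in
  \<open>z - \<mu> \<theta>\<close>.\<close>

lemma is_fisher_information_gaussian_location:
  fixes \<mu> :: "real^'k::finite \<Rightarrow> real^'n::finite" and K :: "real^'n^'n"
  assumes "open \<Theta>" "\<theta> \<in> \<Theta>" and C: "0 < C" and K: "transpose K = K"
    and \<mu>: "\<And>\<theta>'. \<theta>' \<in> \<Theta> \<Longrightarrow> isCont \<mu> \<theta>'" and \<mu>': "(\<mu> has_derivative (\<lambda>\<delta>. A *v \<delta>)) (at \<theta>)"
    and P: "\<And>\<theta>'. \<theta>' \<in> \<Theta> \<Longrightarrow> P \<theta>' =
      density lborel (\<lambda>z. ennreal (C * exp (- ((z - \<mu> \<theta>') \<bullet> (K *v (z - \<mu> \<theta>'))) / 2)))"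
    and int: "\<And>i j. integrable (P \<theta>) (\<lambda>z. ((z - \<mu> \<theta>) \<bullet> (K *v (A *v axis i 1))) * ((z - \<mu> \<theta>) \<bullet> (K *v (A *v axis j 1))))"
  shows "is_fisher_information P \<Theta> \<theta>
    (\<chi> i j. \<integral>z. ((z - \<mu> \<theta>) \<bullet> (K *v (A *v axis i 1))) * ((z - \<mu> \<theta>) \<bullet> (K *v (A *v axis j 1))) \<partial>P \<theta>)"
proof -
  \<comment> \<open>The witness must be jointly measurable over all parameters, while nothing is
    known of \<open>\<mu>\<close> outside \<open>\<Theta>\<close>. The value 0 there is arbitrary
    and, \<open>\<Theta>\<close> being open, leaves the derivative at \<open>\<theta>\<close>
    unchanged.\<close>
  define \<nu> where "\<nu> \<theta>' = (if \<theta>' \<in> \<Theta> then \<mu> \<theta>' else 0)" for \<theta>'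
  define p where "p \<theta>' z = C * exp (- ((z - \<nu> \<theta>') \<bullet> (K *v (z - \<nu> \<theta>'))) / 2)" for \<theta>' z
  have [measurable]: "\<nu> \<in> borel_measurable borel"
    unfolding \<nu>_def using \<open>open \<Theta>\<close> \<mu>
    by (intro borel_measurable_continuous_on_if continuous_at_imp_continuous_on) auto
  have Km[measurable]: "(\<lambda>x. K *v x) \<in> borel_measurable borel"
    by (intro borel_measurable_continuous_onI matrix_vector_mult_linear_continuous_on)
  have "(\<lambda>x. p (fst x) (snd x)) \<in> borel_measurable (borel \<Otimes>\<^sub>M borel)"
    unfolding p_def by measurable
  then have pm: "(\<lambda>(\<theta>', z). p \<theta>' z) \<in> borel_measurable borel"
    by (simp add: borel_prod split_beta')
  have \<nu>': "(\<nu> has_derivative (\<lambda>\<delta>. A *v \<delta>)) (at \<theta>)"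
    by (rule has_derivative_transform_within_open[OF \<mu>' \<open>open \<Theta>\<close> \<open>\<theta> \<in> \<Theta>\<close>]) (simp add: \<nu>_def)
  have \<nu>\<theta>: "\<nu> \<theta> = \<mu> \<theta>" using \<open>\<theta> \<in> \<Theta>\<close> by (simp add: \<nu>_def)
  have swap: "x \<bullet> (K *v y) = y \<bullet> (K *v x)" for x y
    using K by (metis dot_lmul_matrix inner_commute transpose_matrix_vector)
  have lnp: "ln (p \<theta>' z) = ln C - ((z - \<nu> \<theta>') \<bullet> (K *v (z - \<nu> \<theta>'))) / 2" for \<theta>' z
    using C by (simp add: p_def ln_mult)
  have der: "((\<lambda>\<theta>'. ln (p \<theta>' z)) has_derivative (\<lambda>\<delta>. (z - \<mu> \<theta>) \<bullet> (K *v (A *v \<delta>)))) (at \<theta>)" for z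
  proof -
    have 1: "((\<lambda>\<theta>'. z - \<nu> \<theta>') has_derivative (\<lambda>\<delta>. - (A *v \<delta>))) (at \<theta>)"
      using has_derivative_diff[OF has_derivative_const[of z] \<nu>'] by simp
    have 2: "((\<lambda>\<theta>'. K *v (z - \<nu> \<theta>')) has_derivative (\<lambda>\<delta>. K *v - (A *v \<delta>))) (at \<theta>)"
      by (rule bounded_linear.has_derivative[OF matrix_vector_mul_bounded_linear 1])
    have "((\<lambda>\<theta>'. ln C - ((z - \<nu> \<theta>') \<bullet> (K *v (z - \<nu> \<theta>'))) * (1/2)) has_derivative
       (\<lambda>\<delta>. 0 - ((z - \<nu> \<theta>) \<bullet> (K *v - (A *v \<delta>)) + (- (A *v \<delta>)) \<bullet> (K *v (z - \<nu> \<theta>))) * (1/2))) (at \<theta>)"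
      by (intro has_derivative_diff has_derivative_const has_derivative_mult_left has_derivative_inner 1 2)
    \<comment> \<open>Symmetry of \<open>K\<close> makes both terms of the product rule equal, which
      cancels the factor 1/2.\<close>
    also have "(\<lambda>\<delta>. 0 - ((z - \<nu> \<theta>) \<bullet> (K *v - (A *v \<delta>)) + (- (A *v \<delta>)) \<bullet> (K *v (z - \<nu> \<theta>))) * (1/2)) =
      (\<lambda>\<delta>. (z - \<mu> \<theta>) \<bullet> (K *v (A *v \<delta>)))"
      using swap[of "z - \<mu> \<theta>" "- (A *v \<delta>)" for \<delta>] by (auto simp: \<nu>\<theta> swap[of "z - \<mu> \<theta>"])
    finally show ?thesis unfolding lnp by simp
  qed
  have fd: "frechet_derivative (\<lambda>\<theta>'. ln (p \<theta>' z)) (at \<theta>) = (\<lambda>\<delta>. (z - \<mu> \<theta>) \<bullet> (K *v (A *v \<delta>)))" for z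
    using frechet_derivative_at[OF der] by simp
  show ?thesis
    unfolding is_fisher_information_def
  proof (rule exI[of _ p], intro conjI ballI allI)
    show "P \<theta>' = density lborel (\<lambda>z. ennreal (p \<theta>' z))" if "\<theta>' \<in> \<Theta>" for \<theta>'
      using P[OF that] that by (simp add: p_def \<nu>_def)
    show "AE z in P \<theta>. 0 < p \<theta> z \<and> (\<lambda>\<theta>'. ln (p \<theta>' z)) differentiable at \<theta>"
      using der C by (auto simp: differentiable_def p_def)
      show "0 \<le> p \<theta>' z" for \<theta>' z using C by (simp add: p_def)
  qed (use int pm in \<open>simp_all add: fd\<close>)
qed

section \<open>The sampled signal and its noise\<close>

lemma Dop_L2: "(\<And>k. d k \<in> L2 T) \<Longrightarrow> Dop d \<delta> \<in> L2 T"
  unfolding Dop_def by (intro L2_sum L2_cmult)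

lemma inner_L2_Dop:
  assumes "\<And>k. d k \<in> L2 T" "g \<in> L2 T"
  shows "inner_L2 T (Dop d \<delta>) g = (\<Sum>k\<in>UNIV. \<delta> $ k * inner_L2 T (d k) g)"
  unfolding Dop_def using assms by (subst inner_L2_sum_left) (auto simp: L2_cmult inner_L2_cmult_left)

lemma gram_SS_mult:
  assumes "\<And>n. s n \<in> L2 T"
  shows "(gram_SS T s *v x) $ n = inner_L2 T (\<lambda>t. \<Sum>m\<in>UNIV. x $ m * s m t) (s n)"
  using assms
  by (subst inner_L2_sum_left) (auto simp: L2_cmult inner_L2_cmult_left gram_SS_def matrix_vector_mult_def mult.commute)

lemma inner_gram_SS:
  assumes s: "\<And>n. s n \<in> L2 T"
  shows "x \<bullet> (gram_SS T s *v x) = (norm_L2 T (\<lambda>t. \<Sum>n\<in>UNIV. x $ n * s n t))\<^sup>2"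
proof -
  let ?f = "\<lambda>t. \<Sum>n\<in>UNIV. x $ n * s n t"
  have f: "?f \<in> L2 T" using s by (intro L2_sum L2_cmult)
  have "x \<bullet> (gram_SS T s *v x) = (\<Sum>n\<in>UNIV. x $ n * inner_L2 T (s n) ?f)"
    unfolding inner_vec_def gram_SS_mult[OF s] by (simp add: inner_L2_commute)
  also have "\<dots> = inner_L2 T ?f ?f"
    using inner_L2_sum_left[of UNIV "\<lambda>n t. x $ n * s n t" T ?f] s f by (simp add: L2_cmult inner_L2_cmult_left)
  finally show ?thesis by (simp add: norm_L2_power2)
qed

lemma noise_covariance_sym: "transpose (sc2 *\<^sub>R gram_SS T s + sd2 *\<^sub>R mat 1) = sc2 *\<^sub>R gram_SS T s + sd2 *\<^sub>R mat 1"
  by (simp add: transpose_def vec_eq_iff gram_SS_def inner_L2_commute mat_def)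

lemma noise_covariance_mult:
  "(sc2 *\<^sub>R gram_SS T s + sd2 *\<^sub>R mat 1) *v x = sc2 *\<^sub>R (gram_SS T s *v x) + sd2 *\<^sub>R x"
  by (simp add: matrix_vector_mult_add_rdistrib scaleR_matrix_vector_assoc[symmetric])

lemma noise_covariance_inner:
  assumes "\<And>n. s n \<in> L2 T"
  shows "x \<bullet> ((sc2 *\<^sub>R gram_SS T s + sd2 *\<^sub>R mat 1) *v x) =
    sc2 * (norm_L2 T (\<lambda>t. \<Sum>n\<in>UNIV. x $ n * s n t))\<^sup>2 + sd2 * (x \<bullet> x)"
  unfolding noise_covariance_mult by (simp add: inner_add_right inner_gram_SS[OF assms])

text \<open>The form is a sum of nonnegative terms, one per noise source. Since either level may be
  0, definiteness comes from invertibility: a vector at which the form vanishes lies in the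
  kernel.\<close>

lemma noise_covariance_pos_def:
  fixes s :: "'n::finite \<Rightarrow> real \<Rightarrow> real"
  assumes s: "\<And>n. s n \<in> L2 T" and "0 \<le> sc2" "0 \<le> sd2"
    and inv: "invertible (sc2 *\<^sub>R gram_SS T s + sd2 *\<^sub>R mat 1)" and "x \<noteq> 0"
  shows "0 < x \<bullet> ((sc2 *\<^sub>R gram_SS T s + sd2 *\<^sub>R mat 1) *v x)"
proof (rule ccontr)
  let ?V = "sc2 *\<^sub>R gram_SS T s + sd2 *\<^sub>R mat 1" and ?f = "\<lambda>t. \<Sum>n\<in>UNIV. x $ n * s n t"
  assume "\<not> 0 < x \<bullet> (?V *v x)"
  then have "sc2 * (norm_L2 T ?f)\<^sup>2 + sd2 * (x \<bullet> x) \<le> 0"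
    by (simp add: noise_covariance_inner[OF s])
  moreover have "0 \<le> sc2 * (norm_L2 T ?f)\<^sup>2" "0 \<le> sd2 * (x \<bullet> x)" using assms by auto
  ultimately have z: "sc2 * (norm_L2 T ?f)\<^sup>2 = 0" "sd2 * (x \<bullet> x) = 0" by linarith+
  have f: "?f \<in> L2 T" using s by (intro L2_sum L2_cmult)
  \<comment> \<open>Either \<open>sc2\<close> is 0, or \<open>?f\<close> has norm 0 and
    Cauchy-Schwarz applies.\<close>
  have "sc2 * inner_L2 T ?f (s n) = 0" for n
    using z(1) inner_L2_Cauchy_Schwarz[OF f s[of n]] by auto
  then have "?V *v x = 0"
    using z(2) unfolding noise_covariance_mult by (auto simp: vec_eq_iff gram_SS_mult[OF s])
  then have "matrix_inv ?V *v (?V *v x) = 0" by simp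
  then have "x = 0"
    using inv by (simp only: matrix_vector_mul_assoc matrix_inv_left matrix_vector_mul_lid)
  with \<open>x \<noteq> 0\<close> show False ..
qed

text \<open>\<open>white_noise\<close> speaks about sets of functions, whereas the kernels \<open>s n\<close> may coincide.\<close>
lemma white_noise_linear_combination:
  fixes s :: "'n::finite \<Rightarrow> real \<Rightarrow> real"
  assumes "white_noise M T sc2 W" and s: "\<And>n. s n \<in> L2 T"
  shows "gaussian_rv M (\<lambda>\<omega>. \<Sum>n\<in>UNIV. a n * W (s n) \<omega>) 0 (sc2 * (norm_L2 T (\<lambda>t. \<Sum>n\<in>UNIV. a n * s n t))\<^sup>2)"
proof -
  define b where "b f = (\<Sum>n | s n = f. a n)" for f
  have eq: "(\<Sum>f\<in>range s. b f * g f) = (\<Sum>n\<in>UNIV. a n * g (s n))" for g :: "(real \<Rightarrow> real) \<Rightarrow> real"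
    using sum.image_gen[of UNIV "\<lambda>n. a n * g (s n)" s, OF finite] by (simp add: b_def sum_distrib_right)
  have "gaussian_rv M (\<lambda>\<omega>. \<Sum>f\<in>range s. b f * W f \<omega>) 0 (sc2 * (norm_L2 T (\<lambda>t. \<Sum>f\<in>range s. b f * f t))\<^sup>2)"
    using assms(1)[unfolded white_noise_def, rule_format, of "range s" b] s by (simp add: image_subset_iff)
  then show ?thesis
    unfolding eq .
qed

lemma char_distr_cmult:
  assumes [measurable]: "X \<in> borel_measurable M"
  shows "char (distr M borel (\<lambda>\<omega>. a * X \<omega>)) t = char (distr M borel X) (a * t)"
  unfolding char_def by (simp add: integral_distr ac_simps)

text \<open>Continuous and discrete noise contribute independent Gaussian summands; their
  characteristic functions multiply, so the variances add.\<close>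

lemma gaussian_rv_noise_combination:
  fixes s :: "'n::finite \<Rightarrow> real \<Rightarrow> real" and v :: "'n \<Rightarrow> 'a \<Rightarrow> real"
  assumes M: "prob_space M" and W: "white_noise M T sc2 W" and s: "\<And>n. s n \<in> L2 T"
    and "0 \<le> sc2" "0 \<le> sd2" and v: "\<And>n. gaussian_rv M (v n) 0 sd2"
    and v_indep: "prob_space.indep_vars M (\<lambda>_. borel) v UNIV"
    and vW_indep: "prob_space.indep_set M
       (sets (vimage_algebra (space M) (\<lambda>\<omega>. restrict (\<lambda>f. W f \<omega>) (L2 T)) (Pi\<^sub>M (L2 T) (\<lambda>_. borel))))
       (sets (vimage_algebra (space M) (\<lambda>\<omega>. (\<chi> n. v n \<omega>)) borel))"
  shows "gaussian_rv M (\<lambda>\<omega>. u \<bullet> (\<chi> n. W (s n) \<omega> + v n \<omega>)) 0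
    (u \<bullet> ((sc2 *\<^sub>R gram_SS T s + sd2 *\<^sub>R mat 1) *v u))"
proof -
  interpret prob_space M by fact
  define X where "X \<omega> = (\<Sum>n\<in>UNIV. u $ n * W (s n) \<omega>)" for \<omega>
  define Y where "Y \<omega> = (\<Sum>n\<in>UNIV. u $ n * v n \<omega>)" for \<omega>
  have X: "gaussian_rv M X 0 (sc2 * (norm_L2 T (\<lambda>t. \<Sum>n\<in>UNIV. u $ n * s n t))\<^sup>2)"
    unfolding X_def by (rule white_noise_linear_combination[OF W s])
  have vm[measurable]: "v n \<in> borel_measurable M" for n
    using v[of n] by (simp add: gaussian_rv_def)
  have Xm[measurable]: "X \<in> borel_measurable M"
    using X by (simp add: gaussian_rv_def)
  have Ym[measurable]: "Y \<in> borel_measurable M"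
    unfolding Y_def by measurable
  have Ychar: "char (distr M borel Y) t = of_real (exp (- (sd2 * (u \<bullet> u) * t\<^sup>2) / 2))" for t
  proof -
    have "indep_vars (\<lambda>_. borel) (\<lambda>n \<omega>. u $ n * v n \<omega>) UNIV"
      by (rule indep_vars_compose2[OF v_indep]) auto
    then have "char (distr M borel Y) t = (\<Prod>n\<in>UNIV. char (distr M borel (\<lambda>\<omega>. u $ n * v n \<omega>)) t)"
      unfolding Y_def by (rule char_distr_sum)
    also have "\<dots> = (\<Prod>n\<in>UNIV. of_real (exp (- (sd2 * (u $ n * t)\<^sup>2) / 2)))"
      by (simp add: char_distr_cmult gaussian_rv_char[OF M v])
    also have "\<dots> = of_real (exp (\<Sum>n\<in>UNIV. - (sd2 * (u $ n * t)\<^sup>2) / 2))"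
      by (simp add: exp_sum)
    also have "(\<Sum>n\<in>UNIV. - (sd2 * (u $ n * t)\<^sup>2) / 2) = - (sd2 * (u \<bullet> u) * t\<^sup>2) / 2"
      by (simp add: inner_vec_def sum_distrib_left sum_distrib_right sum_divide_distrib sum_negf
          power2_eq_square ac_simps)
    finally show ?thesis .
  qed
  \<comment> \<open>Independence is given for the sigma-algebras of the whole noise processes.
    \<open>X\<close> and \<open>Y\<close> are measurable for these, so they generate smaller
    ones.\<close>
  have indep: "indep_var borel X borel Y"
    unfolding indep_var_eq
  proof (intro conjI Xm Ym)
    let ?FW = "vimage_algebra (space M) (\<lambda>\<omega>. restrict (\<lambda>f. W f \<omega>) (L2 T)) (Pi\<^sub>M (L2 T) (\<lambda>_. borel))"
    let ?Fv = "vimage_algebra (space M) (\<lambda>\<omega>. (\<chi> n. v n \<omega>)) borel"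
    have "(\<lambda>\<omega>. restrict (\<lambda>f. W f \<omega>) (L2 T)) \<in> measurable ?FW (Pi\<^sub>M (L2 T) (\<lambda>_. borel))"
      by (rule measurable_vimage_algebra1) (auto simp: space_PiM)
    then have "(\<lambda>\<omega>. \<Sum>n\<in>UNIV. u $ n * restrict (\<lambda>f. W f \<omega>) (L2 T) (s n)) \<in> borel_measurable ?FW"
      by (rule measurable_compose) (use s in measurable)
    then have X1: "X \<in> borel_measurable ?FW"
      using s by (simp add: X_def[abs_def])
    have "(\<lambda>\<omega>. (\<chi> n. v n \<omega>)) \<in> measurable ?Fv borel"
      by (rule measurable_vimage_algebra1) auto
    then have "(\<lambda>\<omega>. u \<bullet> (\<chi> n. v n \<omega>)) \<in> borel_measurable ?Fv"
      by (rule measurable_compose) simp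
    then have Y1: "Y \<in> borel_measurable ?Fv"
      by (simp add: Y_def[abs_def] inner_vec_def)
    have sub: "sigma_sets (space M) {Z -` A \<inter> space M |A. A \<in> sets borel} \<subseteq> sets F"
      if "Z \<in> borel_measurable F" "space F = space M" for Z :: "'a \<Rightarrow> real" and F
    proof -
      have "sigma_sets (space F) {Z -` A \<inter> space M |A. A \<in> sets borel} \<subseteq> sets F"
        using measurable_sets[OF that(1)] that(2) by (intro sets.sigma_sets_subset) auto
      then show ?thesis using that(2) by simp
    qed
    show "indep_set (sigma_sets (space M) {X -` A \<inter> space M |A. A \<in> sets borel})
       (sigma_sets (space M) {Y -` A \<inter> space M |A. A \<in> sets borel})"
      unfolding indep_set_def
      by (rule indep_sets_mono_sets[OF vW_indep[unfolded indep_set_def]])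
        (use sub[OF X1] sub[OF Y1] in \<open>simp split: bool.split\<close>)
  qed
  have XY: "(\<lambda>\<omega>. u \<bullet> (\<chi> n. W (s n) \<omega> + v n \<omega>)) = (\<lambda>\<omega>. X \<omega> + Y \<omega>)"
    by (simp add: X_def Y_def inner_vec_def sum.distrib distrib_left)
  show ?thesis
    unfolding XY noise_covariance_inner[OF s]
  proof (rule gaussian_rvI_char[OF M])
    show "0 \<le> sc2 * (norm_L2 T (\<lambda>t. \<Sum>n\<in>UNIV. u $ n * s n t))\<^sup>2 + sd2 * (u \<bullet> u)"
      using assms(4,5) by simp
    show "char (distr M borel (\<lambda>\<omega>. X \<omega> + Y \<omega>)) t =
      of_real (exp (- ((sc2 * (norm_L2 T (\<lambda>t. \<Sum>n\<in>UNIV. u $ n * s n t))\<^sup>2 + sd2 * (u \<bullet> u)) * t\<^sup>2) / 2))" for t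
      unfolding char_distr_add[OF indep] gaussian_rv_char[OF M X] Ychar of_real_mult[symmetric] exp_add[symmetric]
      by (simp add: field_simps)
  qed simp
qed

text \<open>Pairing with \<open>g\<close> is a bounded functional by Cauchy-Schwarz, so
  differentiability in norm passes to it. It serves twice: with the kernels \<open>s n\<close> for
  the mean of the samples, and with the functions \<open>d k\<close> for the mean of an unbiased
  estimator.\<close>

lemma has_derivative_inner_L2:
  fixes h :: "real^'k::finite \<Rightarrow> real \<Rightarrow> real"
  assumes "open \<Theta>" "\<theta> \<in> \<Theta>" and h: "\<And>\<theta>'. \<theta>' \<in> \<Theta> \<Longrightarrow> h \<theta>' \<in> L2 T" and d: "\<And>k. d k \<in> L2 T" and g: "g \<in> L2 T"
    and lim: "((\<lambda>\<theta>'. norm_L2 T (\<lambda>t. h \<theta>' t - h \<theta> t - Dop d (\<theta>' - \<theta>) t) / norm (\<theta>' - \<theta>)) \<longlongrightarrow> 0) (at \<theta>)"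
  shows "((\<lambda>\<theta>'. inner_L2 T (h \<theta>') g) has_derivative (\<lambda>\<delta>. inner_L2 T (Dop d \<delta>) g)) (at \<theta>)"
  unfolding has_derivative_iff_norm
proof
  show "bounded_linear (\<lambda>\<delta>. inner_L2 T (Dop d \<delta>) g)"
    unfolding inner_L2_Dop[OF d g]
    by (intro bounded_linear_sum bounded_linear_mult_const bounded_linear_vec_nth)
  have lim': "((\<lambda>\<theta>'. norm_L2 T (\<lambda>t. h \<theta>' t - h \<theta> t - Dop d (\<theta>' - \<theta>) t) / norm (\<theta>' - \<theta>) * norm_L2 T g) \<longlongrightarrow> 0) (at \<theta>)"
    using tendsto_mult_left_zero[OF lim] .
  show "((\<lambda>\<theta>'. norm (inner_L2 T (h \<theta>') g - inner_L2 T (h \<theta>) g - inner_L2 T (Dop d (\<theta>' - \<theta>)) g) /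
      norm (\<theta>' - \<theta>)) \<longlongrightarrow> 0) (at \<theta>)"
  proof (rule tendsto_sandwich[OF _ _ tendsto_const lim'])
    have "\<forall>\<^sub>F \<theta>' in at \<theta>. \<theta>' \<in> \<Theta>"
      using \<open>open \<Theta>\<close> \<open>\<theta> \<in> \<Theta>\<close> by (rule eventually_at_in_open')
    then show "\<forall>\<^sub>F \<theta>' in at \<theta>. norm (inner_L2 T (h \<theta>') g - inner_L2 T (h \<theta>) g - inner_L2 T (Dop d (\<theta>' - \<theta>)) g) /
      norm (\<theta>' - \<theta>) \<le> norm_L2 T (\<lambda>t. h \<theta>' t - h \<theta> t - Dop d (\<theta>' - \<theta>) t) / norm (\<theta>' - \<theta>) * norm_L2 T g"
    proof eventually_elim
      case (elim \<theta>')
      note L2s = h[OF elim] h[OF \<open>\<theta> \<in> \<Theta>\<close>] Dop_L2[OF d, where \<delta>="\<theta>' - \<theta>"]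
      have "inner_L2 T (h \<theta>') g - inner_L2 T (h \<theta>) g - inner_L2 T (Dop d (\<theta>' - \<theta>)) g =
        inner_L2 T (\<lambda>t. h \<theta>' t - h \<theta> t - Dop d (\<theta>' - \<theta>) t) g"
        using L2s g by (simp add: inner_L2_diff_left L2_diff)
      moreover have "\<bar>\<dots>\<bar> \<le> norm_L2 T (\<lambda>t. h \<theta>' t - h \<theta> t - Dop d (\<theta>' - \<theta>) t) * norm_L2 T g"
        using L2s g by (intro inner_L2_Cauchy_Schwarz L2_diff)
      ultimately show ?case by (simp add: divide_right_mono)
    qed
  qed simp
qed

lemma mat_SD_mult:
  assumes "\<And>k. d k \<in> L2 T" "\<And>n. s n \<in> L2 T"
  shows "mat_SD T s d *v \<delta> = (\<chi> n. inner_L2 T (Dop d \<delta>) (s n))"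
  using assms by (simp add: vec_eq_iff mat_SD_def matrix_vector_mult_def inner_L2_Dop mult.commute)

lemma has_derivative_sampled_mean:
  fixes h :: "real^'k::finite \<Rightarrow> real \<Rightarrow> real" and s :: "'n::finite \<Rightarrow> real \<Rightarrow> real"
  assumes "open \<Theta>" "\<theta> \<in> \<Theta>" and "\<And>\<theta>'. \<theta>' \<in> \<Theta> \<Longrightarrow> h \<theta>' \<in> L2 T" and d: "\<And>k. d k \<in> L2 T" and s: "\<And>n. s n \<in> L2 T"
    and "((\<lambda>\<theta>'. norm_L2 T (\<lambda>t. h \<theta>' t - h \<theta> t - Dop d (\<theta>' - \<theta>) t) / norm (\<theta>' - \<theta>)) \<longlongrightarrow> 0) (at \<theta>)"
  shows "((\<lambda>\<theta>'. \<chi> n. inner_L2 T (h \<theta>') (s n)) has_derivative (\<lambda>\<delta>. mat_SD T s d *v \<delta>)) (at \<theta>)"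
  unfolding mat_SD_mult[OF d s]
proof (subst has_derivative_componentwise_within, rule ballI)
  fix b :: "real^'n" assume "b \<in> Basis"
  then obtain n where "b = axis n 1" by (auto simp: Basis_vec_def)
  then show "((\<lambda>\<theta>'. (\<chi> n. inner_L2 T (h \<theta>') (s n)) \<bullet> b) has_derivative
    (\<lambda>\<delta>. (\<chi> n. inner_L2 T (Dop d \<delta>) (s n)) \<bullet> b)) (at \<theta>)"
    using has_derivative_inner_L2[OF assms(1-4) s assms(6), of n] by (simp add: inner_axis)
qed

section \<open>The Cramer-Rao bound\<close>

text \<open>Negative values are truncated by \<open>ennreal\<close>, which can only increase the
  integral. It is meant for a lower bound that may be negative at individual samples.\<close>

lemma ennreal_integral_le_nn_integral:
  assumes "integrable M g"
  shows "ennreal (\<integral>x. g x \<partial>M) \<le> (\<integral>\<^sup>+x. ennreal (g x) \<partial>M)"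
proof -
  have i: "integrable M (\<lambda>x. max 0 (g x))" using assms by simp
  have "ennreal (\<integral>x. g x \<partial>M) \<le> ennreal (\<integral>x. max 0 (g x) \<partial>M)"
    using assms i by (intro ennreal_leI integral_mono) auto
  also have "\<dots> = (\<integral>\<^sup>+x. ennreal (max 0 (g x)) \<partial>M)"
    using i by (intro nn_integral_eq_integral[symmetric]) auto
  also have "\<dots> = (\<integral>\<^sup>+x. ennreal (g x) \<partial>M)"
    by (intro nn_integral_cong) (auto simp: max_def ennreal_neg)
  finally show ?thesis .
qed

lemma
  fixes xh :: "'z::euclidean_space \<Rightarrow> real \<Rightarrow> real"
  assumes xh: "(\<lambda>(z, t). xh z t) \<in> borel_measurable borel"
  shows measurable_inner_L2: "g \<in> L2 T \<Longrightarrow> (\<lambda>z. inner_L2 T (xh z) g) \<in> borel_measurable borel"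
    and measurable_sqnorm_L2: "(\<lambda>z. sqnorm_L2 T (xh z)) \<in> borel_measurable borel"
    and measurable_sqnorm_L2_diff: "k \<in> L2 T \<Longrightarrow> (\<lambda>z. sqnorm_L2 T (\<lambda>t. xh z t - k t)) \<in> borel_measurable borel"
    and measurable_section: "(\<lambda>t. indicator {0..T} t * xh z t) \<in> borel_measurable borel"
proof -
  have [measurable]: "(\<lambda>x. xh (fst x) (snd x)) \<in> borel_measurable (borel \<Otimes>\<^sub>M borel)"
    using xh by (simp add: borel_prod split_beta')
  show "(\<lambda>z. inner_L2 T (xh z) g) \<in> borel_measurable borel" if "g \<in> L2 T"
  proof -
    have [measurable]: "(\<lambda>t. indicator {0..T} t * g t) \<in> borel_measurable borel"
      using that by (simp add: L2_iff)
    show ?thesis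
      unfolding inner_L2_eq by measurable
  qed
  show "(\<lambda>z. sqnorm_L2 T (xh z)) \<in> borel_measurable borel"
    unfolding sqnorm_L2_eq by measurable
  show "(\<lambda>z. sqnorm_L2 T (\<lambda>t. xh z t - k t)) \<in> borel_measurable borel" if "k \<in> L2 T"
  proof -
    have [measurable]: "(\<lambda>t. indicator {0..T} t * k t) \<in> borel_measurable borel"
      using that by (simp add: L2_iff)
    show ?thesis
      unfolding sqnorm_L2_eq right_diff_distrib by measurable
  qed
  have "(\<lambda>t. (z, t)) \<in> borel_measurable borel"
    by (intro borel_measurable_continuous_onI continuous_intros)
  from measurable_compose[OF this xh] have [measurable]: "xh z \<in> borel_measurable borel" by simp
  show "(\<lambda>t. indicator {0..T} t * xh z t) \<in> borel_measurable borel" by measurable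
qed

text \<open>A finite mean squared norm forces almost every realisation into \<open>L2\<close>; there
  Cauchy-Schwarz bounds the scalar statistic by a multiple of the norm.\<close>

lemma integrable_inner_L2_square:
  fixes xh :: "'z::euclidean_space \<Rightarrow> real \<Rightarrow> real"
  assumes xh: "(\<lambda>(z, t). xh z t) \<in> borel_measurable borel" and sP[measurable_cong]: "sets P = sets borel"
    and fin: "(\<integral>\<^sup>+z. sqnorm_L2 T (xh z) \<partial>P) < \<infinity>" and g: "g \<in> L2 T"
  shows "AE z in P. xh z \<in> L2 T" "integrable P (\<lambda>z. (inner_L2 T (xh z) g)\<^sup>2)"
proof -
  note [measurable] = measurable_inner_L2[OF xh g] measurable_sqnorm_L2[OF xh]
  have "AE z in P. sqnorm_L2 T (xh z) \<noteq> \<infinity>"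
    using fin by (intro nn_integral_noteq_infinite) auto
  then show AE: "AE z in P. xh z \<in> L2 T"
    by eventually_elim (intro L2_of_sqnorm_L2 measurable_section[OF xh], simp add: less_top)
  have "(\<integral>\<^sup>+z. ennreal ((inner_L2 T (xh z) g)\<^sup>2) \<partial>P) \<le> (\<integral>\<^sup>+z. sqnorm_L2 T (xh z) * ennreal ((norm_L2 T g)\<^sup>2) \<partial>P)"
  proof (rule nn_integral_mono_AE)
    show "AE z in P. ennreal ((inner_L2 T (xh z) g)\<^sup>2) \<le> sqnorm_L2 T (xh z) * ennreal ((norm_L2 T g)\<^sup>2)"
      using AE
    proof eventually_elim
      case (elim z)
      have "\<bar>inner_L2 T (xh z) g\<bar>\<^sup>2 \<le> (norm_L2 T (xh z) * norm_L2 T g)\<^sup>2"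
        by (intro power_mono inner_L2_Cauchy_Schwarz elim g) simp
      then show ?case
        by (simp add: sqnorm_L2_of_L2[OF elim] ennreal_mult[symmetric] norm_L2_power2[symmetric] power_mult_distrib)
    qed
  qed
  also have "\<dots> < \<infinity>"
    using fin by (simp add: nn_integral_multc ennreal_mult_less_top)
  finally show "integrable P (\<lambda>z. (inner_L2 T (xh z) g)\<^sup>2)"
    by (intro integrableI_nonneg) auto
qed

section \<open>The information inequality under a centred Gaussian law\<close>

context gaussian_law
begin

lemma information_matrix_sym:
  fixes A :: "real^'k^'n"
  shows "transpose (transpose A ** K ** A) = transpose A ** K ** A"
  by (simp add: matrix_transpose_mul K_sym matrix_mul_assoc)

lemma information_matrix_inner:
  fixes A :: "real^'k^'n"
  shows "x \<bullet> ((transpose A ** K ** A) *v y) = (A *v x) \<bullet> (K *v (A *v y))"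
proof -
  have "(transpose A ** K ** A) *v y = transpose A *v (K *v (A *v y))"
    by (simp only: matrix_vector_mul_assoc matrix_mul_assoc)
  then show ?thesis
    using inner_transpose_mult[of A "K *v (A *v y)" x] by (simp add: inner_commute)
qed

text \<open>If the form vanishes at \<open>x\<close>, the score in direction \<open>x\<close> has
  variance 0 and so, by Cauchy-Schwarz, no correlation with any other score. Hence
  \<open>K *v x\<close> is 0, and applying \<open>V\<close> gives \<open>x = 0\<close>.\<close>

lemma K_pos_def:
  assumes "x \<noteq> 0"
  shows "0 < x \<bullet> (K *v x)"
proof (rule ccontr)
  assume "\<not> 0 < x \<bullet> (K *v x)"
  with K_nonneg[of x] have z: "x \<bullet> (K *v x) = 0" by linarith
  have "y \<bullet> (K *v x) = 0" for y
  proof -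
    have "(\<integral>z. (z \<bullet> (K *v y)) * (z \<bullet> (K *v x)) \<partial>P)\<^sup>2 \<le>
      (\<integral>z. (z \<bullet> (K *v y))\<^sup>2 \<partial>P) * (\<integral>z. (z \<bullet> (K *v x))\<^sup>2 \<partial>P)"
      by (intro integral_Cauchy_Schwarz integrable_inner_square) auto
    then show ?thesis by (simp add: integral_score_mult integral_score_square z)
  qed
  then have "K *v x = 0" by (metis inner_eq_zero_iff)
  then have "V *v (K *v x) = 0" by simp
  then have "x = 0" by (simp add: matrix_vector_mul_assoc VK)
  with assms show False ..
qed

lemma information_matrix_invertible:
  fixes A :: "real^'k^'n"
  assumes "\<And>x. A *v x = 0 \<Longrightarrow> x = 0"
  shows "invertible (transpose A ** K ** A)"
proof -
  have "x = 0" if "(transpose A ** K ** A) *v x = 0" for x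
  proof -
    have "(A *v x) \<bullet> (K *v (A *v x)) = 0"
      using information_matrix_inner[of x A x] that by simp
    then have "A *v x = 0" using K_pos_def[of "A *v x"] by fastforce
    then show ?thesis by (rule assms)
  qed
  then show ?thesis
    by (auto simp: invertible_left_inverse matrix_left_invertible_ker)
qed

text \<open>Expanding \<open>0 \<le> \<parallel>e - \<phi>\<parallel>\<^sup>2\<close> pointwise, for the error \<open>e\<close> and the linear combination
  \<open>\<phi>\<close> of the \<open>d k\<close> whose coefficients are the inverse information matrix applied to the score.\<close>
lemma trace_bound:
  fixes A :: "real^'k^'n" and d :: "'k \<Rightarrow> real \<Rightarrow> real" and xh :: "real^'n \<Rightarrow> real \<Rightarrow> real"
  defines "J \<equiv> transpose A ** K ** A"
  assumes J: "invertible J" and d: "\<And>k. d k \<in> L2 T" and x: "x \<in> L2 T"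
    and xh: "(\<lambda>(z, t). xh z t) \<in> borel_measurable borel" and fin: "(\<integral>\<^sup>+z. sqnorm_L2 T (xh z) \<partial>P) < \<infinity>"
    and cov: "\<And>j k. (\<integral>z. inner_L2 T (xh z) (d k) * (z \<bullet> (K *v (A *v axis j 1))) \<partial>P) = inner_L2 T (d j) (d k)"
  shows "ennreal (trace (mat_DD T d ** matrix_inv J)) \<le> (\<integral>\<^sup>+z. sqnorm_L2 T (\<lambda>t. xh z t - x t) \<partial>P)"
proof -
  define Ji where "Ji = matrix_inv J"
  \<comment> \<open>Coordinate \<open>k\<close> of the inverse information matrix applied to the
    score: by linearity, a row of \<open>Ji\<close> acts as a parameter direction.\<close>
  define w where "w k z = z \<bullet> (K *v (A *v row k Ji))" for k z
  define Y where "Y k z = inner_L2 T (xh z) (d k)" for k z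
  define D where "D j k = inner_L2 T (d j) (d k)" for j k
  have Y2: "AE z in P. xh z \<in> L2 T" "integrable P (\<lambda>z. (Y k z)\<^sup>2)" for k
    unfolding Y_def by (rule integrable_inner_L2_square[OF xh sets_P fin d])+
  have [measurable]: "Y k \<in> borel_measurable borel" for k
    unfolding Y_def by (rule measurable_inner_L2[OF xh d])
  have [measurable]: "w k \<in> borel_measurable borel" for k
    unfolding w_def by measurable
  have wi: "integrable P (w k)" "(\<integral>z. w k z \<partial>P) = 0" "integrable P (\<lambda>z. (w k z)\<^sup>2)" for k
    unfolding w_def by (rule integrable_inner integral_inner integrable_inner_square)+
  have wwi: "integrable P (\<lambda>z. w k z * w l z)" for k l
    unfolding w_def by (rule integrable_inner_mult)
  have ww: "(\<integral>z. w k z * w l z \<partial>P) = Ji $ k $ l" for k l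
  proof -
    \<comment> \<open>Symmetry of \<open>J\<close> makes \<open>transpose Ji\<close> a right inverse
      as well.\<close>
    have "J *v row l Ji = axis l 1"
    proof -
      have "Ji ** J = mat 1" unfolding Ji_def using J by (rule matrix_inv_left)
      then have "transpose (Ji ** J) = mat 1" by simp
      then have "J ** transpose Ji = mat 1"
        unfolding matrix_transpose_mul by (simp add: J_def information_matrix_sym)
      moreover have "row l Ji = transpose Ji *v axis l 1"
        by (simp only: matrix_vector_mult_basis column_transpose)
      ultimately show ?thesis by (simp only: matrix_vector_mul_assoc matrix_vector_mul_lid)
    qed
    then show ?thesis
      unfolding w_def integral_score_mult information_matrix_inner[symmetric] J_def[symmetric]
      by (simp add: inner_axis row_def)
  qed
  have Ywi: "integrable P (\<lambda>z. Y k z * w l z)" for k l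
    by (intro integrable_mult_of_square Y2(2) wi) auto
  have Yw: "(\<integral>z. Y k z * w l z \<partial>P) = (\<Sum>j\<in>UNIV. Ji $ l $ j * D j k)" for k l
  proof -
    have "row l Ji = (\<Sum>j\<in>UNIV. (Ji $ l $ j) *\<^sub>R axis j 1)"
      by (simp add: vec_eq_iff row_def axis_def if_distrib cong: if_cong)
    then have "w l z = (\<Sum>j\<in>UNIV. (Ji $ l $ j) * (z \<bullet> (K *v (A *v axis j 1))))" for z
      unfolding w_def
      by (simp add: linear_sum[OF matrix_vector_mul_linear] inner_sum_right matrix_vector_mult_scaleR)
    then have "Y k z * w l z = (\<Sum>j\<in>UNIV. (Ji $ l $ j) * (Y k z * (z \<bullet> (K *v (A *v axis j 1)))))" for z
      by (simp add: sum_distrib_left ac_simps)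
    moreover have "integrable P (\<lambda>z. Y k z * (z \<bullet> a))" for a
      by (intro integrable_mult_of_square Y2(2) integrable_inner_square) auto
    ultimately show ?thesis
      using cov by (simp add: Y_def D_def)
  qed
  define tr where "tr = (\<Sum>k\<in>UNIV. \<Sum>j\<in>UNIV. Ji $ k $ j * D j k)"
  have trace_eq: "trace (mat_DD T d ** matrix_inv J) = tr"
    unfolding trace_def matrix_matrix_mult_def mat_DD_def tr_def Ji_def[symmetric] D_def
    by (subst sum.swap) (intro sum.cong refl, simp add: mult.commute inner_L2_commute)
  \<comment> \<open>Almost everywhere this is \<open>2 * inner_L2 T p e - inner_L2 T p p\<close> for
    the error \<open>e\<close> and the regression \<open>p\<close> below, expanded into moments of
    \<open>Y\<close> and \<open>w\<close>. The terms in \<open>x\<close> vanish in the mean because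
    the scores are centred, and what remains is twice the trace minus the trace.\<close>
  define G where "G z = (\<Sum>k\<in>UNIV. 2 * (Y k z * w k z - inner_L2 T x (d k) * w k z))
    - (\<Sum>k\<in>UNIV. \<Sum>l\<in>UNIV. w k z * w l z * D k l)" for z
  have Gi: "integrable P G"
    unfolding G_def by (intro Bochner_Integration.integrable_diff Bochner_Integration.integrable_sum
      integrable_mult_right integrable_mult_left Ywi wi wwi)
  have "(\<integral>z. G z \<partial>P) = (\<Sum>k\<in>UNIV. 2 * (\<Sum>j\<in>UNIV. Ji $ k $ j * D j k)) - (\<Sum>k\<in>UNIV. \<Sum>l\<in>UNIV. Ji $ k $ l * D k l)"
    unfolding G_def using Ywi wi wwi by (simp add: Yw ww)
  also have "(\<Sum>k\<in>UNIV. \<Sum>l\<in>UNIV. Ji $ k $ l * D k l) = tr"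
    unfolding tr_def D_def by (intro sum.cong refl) (simp add: inner_L2_commute)
  also have "(\<Sum>k\<in>UNIV. 2 * (\<Sum>j\<in>UNIV. Ji $ k $ j * D j k)) - tr = tr"
    unfolding tr_def by (simp add: sum_distrib_left[symmetric])
  finally have G_int: "(\<integral>z. G z \<partial>P) = tr" .
  have "ennreal tr \<le> (\<integral>\<^sup>+z. ennreal (G z) \<partial>P)"
    using ennreal_integral_le_nn_integral[OF Gi] by (simp add: G_int)
  also have "\<dots> \<le> (\<integral>\<^sup>+z. sqnorm_L2 T (\<lambda>t. xh z t - x t) \<partial>P)"
  proof (rule nn_integral_mono_AE)
    show "AE z in P. ennreal (G z) \<le> sqnorm_L2 T (\<lambda>t. xh z t - x t)"
      using Y2(1)
    proof eventually_elim
      case (elim z)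
      define e where "e t = xh z t - x t" for t
      define p where "p t = (\<Sum>k\<in>UNIV. w k z * d k t)" for t
      have e: "e \<in> L2 T" unfolding e_def by (intro L2_diff elim x)
      have p: "p \<in> L2 T" unfolding p_def by (intro L2_sum L2_cmult d)
      have pg: "inner_L2 T p g = (\<Sum>k\<in>UNIV. w k z * inner_L2 T (d k) g)" if "g \<in> L2 T" for g
        unfolding p_def using d that
        by (subst inner_L2_sum_left) (auto simp: L2_cmult inner_L2_cmult_left)
      have "0 \<le> inner_L2 T (\<lambda>t. e t - p t) (\<lambda>t. e t - p t)"
        unfolding norm_L2_power2[symmetric] by simp
      also have "\<dots> = inner_L2 T e e - 2 * inner_L2 T p e + inner_L2 T p p"
        using e p L2_diff[OF e p] inner_L2_commute[of T e "\<lambda>t. e t - p t"] inner_L2_commute[of T p "\<lambda>t. e t - p t"]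
          inner_L2_commute[of T e p]
        by (simp add: inner_L2_diff_left)
      finally have "2 * inner_L2 T p e - inner_L2 T p p \<le> inner_L2 T e e" by simp
      moreover
      have de: "inner_L2 T (d k) e = Y k z - inner_L2 T x (d k)" for k
        unfolding inner_L2_commute[of T "d k"] e_def Y_def using elim x d by (simp add: inner_L2_diff_left)
      have "2 * inner_L2 T p e = (\<Sum>k\<in>UNIV. 2 * (Y k z * w k z - inner_L2 T x (d k) * w k z))"
        unfolding pg[OF e] by (simp add: de sum_distrib_left algebra_simps)
      moreover have "inner_L2 T (d k) p = (\<Sum>l\<in>UNIV. w l z * D k l)" for k
        using pg[OF d[of k]] by (simp add: D_def inner_L2_commute[of T "d k"])
      then have "inner_L2 T p p = (\<Sum>k\<in>UNIV. \<Sum>l\<in>UNIV. w k z * w l z * D k l)"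
        unfolding pg[OF p] by (simp add: sum_distrib_left mult.assoc)
      ultimately have "G z \<le> inner_L2 T e e"
        unfolding G_def by simp
      moreover have "(\<lambda>t. xh z t - x t) = e" by (simp add: e_def fun_eq_iff)
      ultimately show ?case
        using sqnorm_L2_of_L2[OF e] by (simp add: ennreal_leI)
    qed
  qed
  finally show ?thesis unfolding trace_eq .
qed

end

theorem theorem3:
  fixes T0 sc2 sd2 :: real
    and \<Theta> :: "(real^'k::finite) set"
    and h :: "real^'k \<Rightarrow> real \<Rightarrow> real"
    and d :: "real^'k \<Rightarrow> 'k \<Rightarrow> real \<Rightarrow> real"
    and s :: "'n::finite \<Rightarrow> real \<Rightarrow> real"
    and M :: "'a measure"
    and W :: "(real \<Rightarrow> real) \<Rightarrow> 'a \<Rightarrow> real"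
    and v :: "'n \<Rightarrow> 'a \<Rightarrow> real"
    and c :: "real^'k \<Rightarrow> 'a \<Rightarrow> real^'n"
    and \<theta> :: "real^'k"
  assumes T0: "T0 > 0"
    and Theta_open: "open \<Theta>"
    and h_L2: "\<forall>\<theta>'\<in>\<Theta>. h \<theta>' \<in> L2 T0"
    (* (P6): Frechet differentiability of theta -> h_theta into L2, derivative D_theta = Dop (d theta) *)
    and d_L2: "\<forall>\<theta>'\<in>\<Theta>. \<forall>k. d \<theta>' k \<in> L2 T0"
    and P6: "\<forall>\<theta>'\<in>\<Theta>. ((\<lambda>\<theta>''. norm_L2 T0 (\<lambda>t. h \<theta>'' t - h \<theta>' t - Dop (d \<theta>') (\<theta>'' - \<theta>') t)
                                  / norm (\<theta>'' - \<theta>')) \<longlongrightarrow> 0) (at \<theta>')"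
    (* (P7): trivial null space of D_theta *)
    and P7: "\<forall>\<theta>'\<in>\<Theta>. \<forall>\<delta>. norm_L2 T0 (Dop (d \<theta>') \<delta>) = 0 \<longrightarrow> \<delta> = 0"
    and s_L2: "\<forall>n. s n \<in> L2 T0"
    and sc2: "sc2 \<ge> 0" and sd2: "sd2 \<ge> 0"
    and M: "prob_space M"
    and W: "white_noise M T0 sc2 W"
    and v_gauss: "\<forall>n. gaussian_rv M (v n) 0 sd2"
    and v_indep: "prob_space.indep_vars M (\<lambda>_. borel) v UNIV"
    and vW_indep: "prob_space.indep_set M
                     (sets (vimage_algebra (space M) (\<lambda>\<omega>. restrict (\<lambda>f. W f \<omega>) (L2 T0)) (Pi\<^sub>M (L2 T0) (\<lambda>_. borel))))
                     (sets (vimage_algebra (space M) (\<lambda>\<omega>. (\<chi> n. v n \<omega>)) borel))"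
    and c_def: "\<forall>\<theta>' \<omega>. c \<theta>' \<omega> = (\<chi> n. inner_L2 T0 (h \<theta>') (s n) + W (s n) \<omega> + v n \<omega>)"
    and inv: "invertible (sc2 *\<^sub>R gram_SS T0 s + sd2 *\<^sub>R mat 1)"
    and theta: "\<theta> \<in> \<Theta>"
  shows "fisher_information (\<lambda>\<theta>'. distr M borel (c \<theta>')) \<Theta> \<theta> = J_samp T0 sc2 sd2 s (d \<theta>)
    \<and> ((\<forall>\<delta>. (\<forall>n. inner_L2 T0 (Dop (d \<theta>) \<delta>) (s n) = 0) \<longrightarrow> norm_L2 T0 (Dop (d \<theta>) \<delta>) = 0) \<longrightarrow>
         invertible (J_samp T0 sc2 sd2 s (d \<theta>)) \<and>
         (\<forall>xh :: real^'n \<Rightarrow> real \<Rightarrow> real.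
            (\<lambda>(z, t). xh z t) \<in> borel_measurable borel \<and>
            (\<forall>\<theta>'\<in>\<Theta>. (\<integral>\<^sup>+ \<omega>. sqnorm_L2 T0 (xh (c \<theta>' \<omega>)) \<partial>M) < \<infinity>) \<and>
            (\<forall>\<theta>'\<in>\<Theta>. \<forall>g\<in>L2 T0. (\<integral>\<omega>. inner_L2 T0 (xh (c \<theta>' \<omega>)) g \<partial>M) = inner_L2 T0 (h \<theta>') g)
            \<longrightarrow> (\<integral>\<^sup>+ \<omega>. sqnorm_L2 T0 (\<lambda>t. xh (c \<theta> \<omega>) t - h \<theta> t) \<partial>M)
                  \<ge> ennreal (trace (mat_DD T0 (d \<theta>) ** matrix_inv (J_samp T0 sc2 sd2 s (d \<theta>))))))"
proof -
  interpret M: prob_space M by fact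
  note s = s_L2[rule_format] and hL2 = h_L2[rule_format] and dL2 = d_L2[rule_format]
  define V where "V = sc2 *\<^sub>R gram_SS T0 s + sd2 *\<^sub>R mat 1"
  define K where "K = matrix_inv V"
  define \<nu> where "\<nu> \<omega> = (\<chi> n. W (s n) \<omega> + v n \<omega>)" for \<omega>
  define P where "P = distr M borel \<nu>"
  define \<mu> where "\<mu> \<theta>' = (\<chi> n. inner_L2 T0 (h \<theta>') (s n))" for \<theta>'
  define A where "A = mat_SD T0 s (d \<theta>)"
  have c: "c \<theta>' \<omega> = \<mu> \<theta>' + \<nu> \<omega>" for \<theta>' \<omega>
    using c_def by (simp add: \<mu>_def \<nu>_def vec_eq_iff)
  have gauss: "gaussian_rv M (\<lambda>\<omega>. u \<bullet> \<nu> \<omega>) 0 (u \<bullet> (V *v u))" for u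
    unfolding \<nu>_def V_def
    by (rule gaussian_rv_noise_combination[OF M W s sc2 sd2 v_gauss[rule_format] v_indep vW_indep])
  have \<nu>[measurable]: "\<nu> \<in> borel_measurable M"
    unfolding borel_measurable_euclidean_space[of \<nu>]
    using gauss by (auto simp: gaussian_rv_def inner_commute)
  have chr: "(CLINT \<omega>|M. iexp (u \<bullet> \<nu> \<omega>)) = of_real (exp (- (u \<bullet> (V *v u)) / 2))" for u
    using gaussian_rv_char[OF M gauss[of u], of 1] by (simp add: char_def integral_distr)
  have V_sym: "transpose V = V" unfolding V_def by (rule noise_covariance_sym)
  have V_pos: "0 < x \<bullet> (V *v x)" if "x \<noteq> 0" for x
    unfolding V_def by (rule noise_covariance_pos_def[OF s sc2 sd2 inv that])
  have VK: "V ** K = mat 1" unfolding K_def V_def using inv by (rule matrix_inv_right)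
  have K_sym: "transpose K = K"
  proof -
    \<comment> \<open>As \<open>V\<close> is symmetric, the transpose of \<open>K\<close> is a left
      inverse of \<open>V\<close>, hence equal to \<open>K\<close>.\<close>
    have "transpose K ** V = transpose (V ** K)" by (simp add: matrix_transpose_mul V_sym)
    then have "transpose K ** V = mat 1" by (simp add: VK)
    from matrix_inv_uniqueI[OF this] show ?thesis by (simp add: K_def)
  qed
  obtain C where C: "0 < C" and P_eq: "P = density lborel (\<lambda>z. ennreal (C * exp (- (z \<bullet> (K *v z)) / 2)))"
    using gaussian_vector_density[OF M \<nu> chr V_sym V_pos] unfolding P_def K_def by blast
  interpret gaussian_law P K V C
  proof (rule gaussian_law.intro)
    show "prob_space P" unfolding P_def by (rule M.prob_space_distr) simp
    have swap: "z \<bullet> a = a \<bullet> z" for z a :: "real^'n" by (rule inner_commute)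
    fix a
    note mom = gaussian_rv_moments[OF M gauss[of a]]
    show "integrable P (\<lambda>z. z \<bullet> a)" "integrable P (\<lambda>z. (z \<bullet> a)\<^sup>2)"
      unfolding P_def swap[of _ a] using mom by (simp_all add: integrable_distr_eq)
    show "(\<integral>z. z \<bullet> a \<partial>P) = 0" "(\<integral>z. (z \<bullet> a)\<^sup>2 \<partial>P) = a \<bullet> (V *v a)"
      unfolding P_def swap[of _ a] using mom by (simp_all add: integral_distr)
  qed (fact P_eq C K_sym VK)+
  \<comment> \<open>The parameter only translates the fixed noise law \<open>P\<close>.\<close>
  have law: "distr M borel (c \<theta>') = distr P borel (\<lambda>z. \<mu> \<theta>' + z)" for \<theta>'
    unfolding P_def by (subst distr_distr) (auto simp: comp_def c[abs_def])
  have J: "J_samp T0 sc2 sd2 s (d \<theta>) = transpose A ** K ** A"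
    unfolding J_samp_def A_def K_def V_def ..
  have \<mu>': "(\<mu> has_derivative (\<lambda>\<delta>. mat_SD T0 s (d \<theta>') *v \<delta>)) (at \<theta>')" if "\<theta>' \<in> \<Theta>" for \<theta>'
    unfolding \<mu>_def
    by (rule has_derivative_sampled_mean[OF Theta_open that hL2 dL2[OF that] s P6[rule_format, OF that]])
  have fisher: "is_fisher_information (\<lambda>\<theta>'. distr M borel (c \<theta>')) \<Theta> \<theta> (transpose A ** K ** A)"
  proof -
    let ?P = "\<lambda>\<theta>'. distr M borel (c \<theta>')"
    have int: "integrable (?P \<theta>) (\<lambda>z. ((z - \<mu> \<theta>) \<bullet> a) * ((z - \<mu> \<theta>) \<bullet> b))" for a b
      unfolding law by (subst integrable_distr_eq) (auto simp: integrable_inner_mult)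
    have val: "(\<integral>z. ((z - \<mu> \<theta>) \<bullet> (K *v (A *v axis i 1))) * ((z - \<mu> \<theta>) \<bullet> (K *v (A *v axis j 1))) \<partial>?P \<theta>) =
        (transpose A ** K ** A) $ i $ j" for i j
    proof -
      have "(\<integral>z. ((z - \<mu> \<theta>) \<bullet> (K *v (A *v axis i 1))) * ((z - \<mu> \<theta>) \<bullet> (K *v (A *v axis j 1))) \<partial>?P \<theta>) =
        (\<integral>z. (z \<bullet> (K *v (A *v axis i 1))) * (z \<bullet> (K *v (A *v axis j 1))) \<partial>P)"
        unfolding law by (subst integral_distr) auto
      also have "\<dots> = axis i 1 \<bullet> ((transpose A ** K ** A) *v axis j 1)"
        by (simp only: integral_score_mult information_matrix_inner)
      also have "\<dots> = (transpose A ** K ** A) $ i $ j"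
        by (simp only: matrix_vector_mult_basis inner_axis') (simp add: column_def)
      finally show ?thesis .
    qed
    have "is_fisher_information ?P \<Theta> \<theta>
      (\<chi> i j. \<integral>z. ((z - \<mu> \<theta>) \<bullet> (K *v (A *v axis i 1))) * ((z - \<mu> \<theta>) \<bullet> (K *v (A *v axis j 1))) \<partial>?P \<theta>)"
    proof (rule is_fisher_information_gaussian_location[OF Theta_open theta C K_sym])
      show "isCont \<mu> \<theta>'" if "\<theta>' \<in> \<Theta>" for \<theta>'
        using \<mu>'[OF that] by (rule has_derivative_continuous)
      show "(\<mu> has_derivative (*v) A) (at \<theta>)" unfolding A_def by (rule \<mu>'[OF theta])
    qed (rule law[THEN trans, OF distr_translate], rule int)
    then show ?thesis unfolding val by (simp add: vec_lambda_eta)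
  qed
  have "fisher_information (\<lambda>\<theta>'. distr M borel (c \<theta>')) \<Theta> \<theta> = J_samp T0 sc2 sd2 s (d \<theta>)"
    unfolding fisher_information_def J
    using fisher is_fisher_information_unique[OF Theta_open theta _ fisher] by (rule the_equality)
  moreover have "invertible (J_samp T0 sc2 sd2 s (d \<theta>))"
    if null: "\<forall>\<delta>. (\<forall>n. inner_L2 T0 (Dop (d \<theta>) \<delta>) (s n) = 0) \<longrightarrow> norm_L2 T0 (Dop (d \<theta>) \<delta>) = 0"
    unfolding J
  proof (rule information_matrix_invertible)
    fix \<delta> assume "A *v \<delta> = 0"
    then have "\<forall>n. inner_L2 T0 (Dop (d \<theta>) \<delta>) (s n) = 0"
      unfolding A_def mat_SD_mult[OF dL2[OF theta] s] by (simp add: vec_eq_iff)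
    \<comment> \<open>The range condition gives a derivative of norm 0 in direction
      \<open>\<delta>\<close>, and injectivity of the derivative gives
      \<open>\<delta> = 0\<close>.\<close>
    with null P7 theta show "\<delta> = 0" by blast
  qed
  moreover have "ennreal (trace (mat_DD T0 (d \<theta>) ** matrix_inv (J_samp T0 sc2 sd2 s (d \<theta>))))
      \<le> (\<integral>\<^sup>+ \<omega>. sqnorm_L2 T0 (\<lambda>t. xh (c \<theta> \<omega>) t - h \<theta> t) \<partial>M)"
    if inv: "invertible (J_samp T0 sc2 sd2 s (d \<theta>))"
      and xh: "(\<lambda>(z, t). xh z t) \<in> borel_measurable borel"
      and fin: "\<forall>\<theta>'\<in>\<Theta>. (\<integral>\<^sup>+ \<omega>. sqnorm_L2 T0 (xh (c \<theta>' \<omega>)) \<partial>M) < \<infinity>"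
      and unb: "\<forall>\<theta>'\<in>\<Theta>. \<forall>g\<in>L2 T0. (\<integral>\<omega>. inner_L2 T0 (xh (c \<theta>' \<omega>)) g \<partial>M) = inner_L2 T0 (h \<theta>') g"
    for xh
  proof -
    \<comment> \<open>Recentring by the mean at \<open>\<theta>\<close> makes the argument follow
      \<open>P\<close> there; at another parameter it is shifted by the difference of the
      means.\<close>
    define x0 where "x0 z = xh (\<mu> \<theta> + z)" for z
    have "(\<lambda>(z, t). (\<mu> \<theta> + z, t)) \<in> borel_measurable borel"
      unfolding split_beta' by (intro borel_measurable_continuous_onI continuous_intros)
    from measurable_compose[OF this xh] have x0: "(\<lambda>(z, t). x0 z t) \<in> borel_measurable borel"
      by (simp add: x0_def split_beta')
    have x0c: "xh (c \<theta> \<omega>) = x0 (\<nu> \<omega>)" for \<omega> by (simp add: x0_def c)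
    have fin0: "(\<integral>\<^sup>+z. sqnorm_L2 T0 (x0 z) \<partial>P) < \<infinity>"
      using bspec[OF fin theta] unfolding P_def by (simp add: nn_integral_distr measurable_sqnorm_L2[OF x0] x0c)
    have cov: "(\<integral>z. inner_L2 T0 (x0 z) (d \<theta> k) * (z \<bullet> (K *v (A *v axis j 1))) \<partial>P) = inner_L2 T0 (d \<theta> j) (d \<theta> k)"
      for j k
    \<comment> \<open>Moving the parameter along axis \<open>j\<close> shifts the mean along this
      path, whose derivative at 0 is column \<open>j\<close> of \<open>A\<close>.\<close>
    proof (rule integral_mult_score[where m="\<lambda>t. \<mu> (\<theta> + t *\<^sub>R axis j 1) - \<mu> \<theta>"])
      note dk = dL2[OF theta, of k]
      show F: "(\<lambda>z. inner_L2 T0 (x0 z) (d \<theta> k)) \<in> borel_measurable borel"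
        by (rule measurable_inner_L2[OF x0 dk])
      show "integrable P (\<lambda>z. (inner_L2 T0 (x0 z) (d \<theta> k))\<^sup>2)"
        by (rule integrable_inner_L2_square[OF x0 sets_P fin0 dk])
      show "((\<lambda>t. (1 / t) *\<^sub>R (\<mu> (\<theta> + t *\<^sub>R axis j 1) - \<mu> \<theta>)) \<longlongrightarrow> A *v axis j 1) (at 0)"
        using has_derivative_imp_directional_tendsto[OF \<mu>'[OF theta]] by (simp add: A_def)
      have "((\<lambda>t. (1 / t) *\<^sub>R (inner_L2 T0 (h (\<theta> + t *\<^sub>R axis j 1)) (d \<theta> k) - inner_L2 T0 (h \<theta>) (d \<theta> k)))
          \<longlongrightarrow> inner_L2 T0 (Dop (d \<theta>) (axis j 1)) (d \<theta> k)) (at 0)"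
        by (rule has_derivative_imp_directional_tendsto[OF has_derivative_inner_L2[OF Theta_open theta hL2
          dL2[OF theta] dk P6[rule_format, OF theta]]])
      moreover have "Dop (d \<theta>) (axis j 1) = d \<theta> j"
        by (simp add: Dop_def axis_def if_distrib[where f="\<lambda>x. x * _"] cong: if_cong)
      moreover have "\<forall>\<^sub>F t in at 0. (1 / t) *\<^sub>R (inner_L2 T0 (h (\<theta> + t *\<^sub>R axis j 1)) (d \<theta> k) - inner_L2 T0 (h \<theta>) (d \<theta> k)) =
        ((\<integral>z. inner_L2 T0 (x0 (\<mu> (\<theta> + t *\<^sub>R axis j 1) - \<mu> \<theta> + z)) (d \<theta> k) \<partial>P)
          - (\<integral>z. inner_L2 T0 (x0 z) (d \<theta> k) \<partial>P)) / t"
      proof -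
        \<comment> \<open>Unbiasedness at \<open>\<theta>'\<close>, tested against
          \<open>d \<theta> k\<close>, becomes the mean of a shifted statistic under the fixed law
          \<open>P\<close>.\<close>
        have mean: "(\<integral>z. inner_L2 T0 (x0 (\<mu> \<theta>' - \<mu> \<theta> + z)) (d \<theta> k) \<partial>P) = inner_L2 T0 (h \<theta>') (d \<theta> k)"
          if "\<theta>' \<in> \<Theta>" for \<theta>'
        proof -
          have "(\<integral>z. inner_L2 T0 (x0 (\<mu> \<theta>' - \<mu> \<theta> + z)) (d \<theta> k) \<partial>P) =
            (\<integral>\<omega>. inner_L2 T0 (x0 (\<mu> \<theta>' - \<mu> \<theta> + \<nu> \<omega>)) (d \<theta> k) \<partial>M)"
            unfolding P_def by (intro integral_distr \<nu> measurable_compose[OF _ F]) simp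
          also have "\<dots> = inner_L2 T0 (h \<theta>') (d \<theta> k)"
            using unb that dk by (simp add: x0_def c)
          finally show ?thesis .
        qed
        have "((\<lambda>t. \<theta> + t *\<^sub>R axis j 1) \<longlongrightarrow> \<theta> + 0 *\<^sub>R axis j 1) (at 0)"
          by (intro tendsto_intros)
        then have "\<forall>\<^sub>F t in at 0. \<theta> + t *\<^sub>R axis j 1 \<in> \<Theta>"
          using Theta_open theta by (auto dest: topological_tendstoD)
        then show ?thesis
          by eventually_elim (use mean[OF theta] in \<open>simp add: mean\<close>)
      qed
      ultimately show "((\<lambda>t. ((\<integral>z. inner_L2 T0 (x0 (\<mu> (\<theta> + t *\<^sub>R axis j 1) - \<mu> \<theta> + z)) (d \<theta> k) \<partial>P)
          - (\<integral>z. inner_L2 T0 (x0 z) (d \<theta> k) \<partial>P)) / t) \<longlongrightarrow> inner_L2 T0 (d \<theta> j) (d \<theta> k)) (at 0)"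
        by (auto elim: Lim_transform_eventually)
    qed
    have "ennreal (trace (mat_DD T0 (d \<theta>) ** matrix_inv (J_samp T0 sc2 sd2 s (d \<theta>))))
      \<le> (\<integral>\<^sup>+z. sqnorm_L2 T0 (\<lambda>t. x0 z t - h \<theta> t) \<partial>P)"
      unfolding J by (rule trace_bound[OF inv[unfolded J] dL2[OF theta] hL2[OF theta] x0 fin0 cov])
    also have "\<dots> = (\<integral>\<^sup>+ \<omega>. sqnorm_L2 T0 (\<lambda>t. xh (c \<theta> \<omega>) t - h \<theta> t) \<partial>M)"
      unfolding P_def x0c by (intro nn_integral_distr \<nu>) (simp add: measurable_sqnorm_L2_diff[OF x0 hL2[OF theta]])
    finally show ?thesis .
  qed
  ultimately show ?thesis by blast
qed

end
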